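(* Assume that for every $\alpha\ge1$, $$\sup_{N\ge1}\Big\|\frac1{\sqrt N}\sum_{j=1}^N\boldsymbol\lambda(j)z^j\Big\|_{L^\alpha(S^1,dz)}<+\infty\quad\text{and}\quad\sup_{N\ge1}\Big\|\frac1{\sqrt N}\sum_{j=1}^N\boldsymbol\mu(j)z^j\Big\|_{L^\alpha(S^1,dz)}<+\infty.$$ Then the Riemann Hypothesis holds, i.e. all nontrivial zeros of the Riemann zeta function lie on the line $\mathrm{Re}(s)=\frac12$.
   Context: $S^1$ is the unit circle with normalized Lebesgue measure $dz$. $\boldsymbol\lambda$ is the Liouville function ($\boldsymbol\lambda(1)=1$, $\boldsymbol\lambda(n)=(-1)^r$ if $n$ is a product of $r$ not necessarily distinct primes) and $\boldsymbol\mu$ is the Möbius function ($\boldsymbol\mu(n)=\boldsymbol\lambda(n)$ if $n$ is squarefree, $0$ otherwise). *)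

theory Defs
  imports
    "HOL-Complex_Analysis.Complex_Analysis"
    "HOL-Computational_Algebra.Computational_Algebra"
begin

definition liouville :: "nat \<Rightarrow> int" where
  "liouville n = (-1) ^ size (prime_factorization n)"

definition moebius_mu :: "nat \<Rightarrow> int" where
  "moebius_mu n = (if squarefree n then liouville n else 0)"

definition circle_measure :: "complex measure" where
  "circle_measure = distr (uniform_measure lborel {0..2 * pi}) borel cis"

lemma integral_circle_measure:
  fixes f :: "complex \<Rightarrow> real"
  assumes [measurable]: "f \<in> borel_measurable borel"
  shows "integral\<^sup>L circle_measure f = 1 / (2 * pi) * (LINT t:{0..2 * pi}|lborel. f (cis t))"
proof -
  have [measurable]: "cis \<in> borel_measurable borel"
    by (intro borel_measurable_continuous_onI continuous_intros)
  have d: "uniform_measure lborel {0..2 * pi} =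
      density lborel (\<lambda>t. ennreal (indicator {0..2 * pi} t / (2 * pi)))"
    unfolding uniform_measure_def
    by (rule density_cong) (auto simp: indicator_def divide_ennreal simp flip: ennreal_1)
  have "integral\<^sup>L circle_measure f = (LINT t|uniform_measure lborel {0..2 * pi}. f (cis t))"
    unfolding circle_measure_def by (rule integral_distr) (auto simp: uniform_measure_def)
  also have "\<dots> = (LINT t|lborel. (indicator {0..2 * pi} t / (2 * pi)) *\<^sub>R f (cis t))"
    unfolding d by (rule integral_density) auto
  also have "\<dots> = 1 / (2 * pi) * (LINT t:{0..2 * pi}|lborel. f (cis t))"
    unfolding set_lebesgue_integral_def by (subst integral_mult_right_zero[symmetric]) (simp add: field_simps)
  finally show ?thesis .
qed

text \<open>
  Without an integrability hypothesis the Bochner integral below may take its default value 0;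
  the functions used here are trigonometric polynomials, for which it is a genuine integral.
\<close>

definition Lp_norm :: "real \<Rightarrow> 'a measure \<Rightarrow> ('a \<Rightarrow> complex) \<Rightarrow> real" where
  "Lp_norm p M f = (integral\<^sup>L M (\<lambda>x. norm (f x) powr p)) powr (1 / p)"

definition normalized_exp_sum :: "(nat \<Rightarrow> int) \<Rightarrow> nat \<Rightarrow> complex \<Rightarrow> complex" where
  "normalized_exp_sum a N z = 1 / of_real (sqrt (real N)) * (\<Sum>j=1..N. of_int (a j) * z ^ j)"

definition is_zeta :: "(complex \<Rightarrow> complex) \<Rightarrow> bool" where
  "is_zeta f \<longleftrightarrow> f holomorphic_on (-{1}) \<and>
     (\<forall>s. Re s > 1 \<longrightarrow> (\<lambda>n. 1 / of_nat (Suc n) powr s) sums f s)"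

text \<open>
  The Riemann zeta function as the analytic continuation of its Dirichlet series to the
  complement of 1. Lemmas \<open>is_zeta_zeta\<close> and \<open>is_zeta_unique\<close> below show that
  it exists and is unique; its value at the pole 1 is unspecified.
\<close>

definition zeta :: "complex \<Rightarrow> complex" where
  "zeta = (SOME f. is_zeta f)"

definition nontrivial_zeta_zero :: "complex \<Rightarrow> bool" where
  "nontrivial_zeta_zero s \<longleftrightarrow>
     s \<noteq> 1 \<and> zeta s = 0 \<and> (\<nexists>n::nat. n \<ge> 1 \<and> s = - 2 * of_nat n)"

lemma is_zeta_unique:
  assumes "is_zeta f" "is_zeta g" "s \<noteq> 1"
  shows "f s = g s"
proof -
  have 1: "(\<lambda>s. f s - g s) holomorphic_on (-{1})"
    using assms(1,2) by (auto simp: is_zeta_def intro!: holomorphic_intros)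
  have 2: "f w - g w = 0" if "w \<in> {w. Re w > 1}" for w
    using assms(1,2) that sums_unique2 by (fastforce simp: is_zeta_def)
  have lim: "(2::complex) islimpt {w. Re w > 1}"
    by (rule interior_limit_point) (simp add: interior_open open_halfspace_Re_gt)
  have "f s - g s = 0"
  proof (rule analytic_continuation[OF 1 _ _ _ _ lim 2])
    show "connected (- {1::complex})"
      by (rule connected_punctured_universe) simp
  qed (use assms(3) in auto)
  thus ?thesis by simp
qed

lemma series_holomorphic:
  fixes f :: "nat \<Rightarrow> complex \<Rightarrow> complex" and K :: real
  assumes hol: "\<And>n. f n holomorphic_on UNIV"
    and C: "continuous_on UNIV C"
    and bound: "\<And>n s. Re s > 1 - K \<Longrightarrow> cmod (f n s) \<le> C s * real (Suc n) powr (- Re s - K)"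
  shows "(\<lambda>s. \<Sum>n. f n s) holomorphic_on {s. Re s > 1 - K}"
    and "Re s > 1 - K \<Longrightarrow> summable (\<lambda>n. f n s)"
proof -
  let ?S = "{s. Re s > 1 - K}"
  have opn: "open ?S" by (simp add: open_halfspace_Re_gt)
  have "\<exists>g. \<forall>x\<in>?S. (\<lambda>n. f n x) sums g x \<and> g field_differentiable (at x)"
  proof (rule series_differentiable_comparison_complex[OF opn, of f])
    show "f n field_differentiable (at x)" for n x
      using hol[of n] by (simp add: holomorphic_on_def)
    fix x assume x: "x \<in> ?S"
    define d where "d = (Re x - (1 - K)) / 2"
    have d: "d > 0" using x by (simp add: d_def)
    have "compact (C ` cball x d)"
      by (intro compact_continuous_image continuous_on_subset[OF C]) auto
    then obtain B where B: "\<And>y. y \<in> cball x d \<Longrightarrow> C y \<le> B" "B > 0"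
      by (metis bounded_pos compact_imp_bounded imageI real_norm_def abs_le_D1)
    define h where "h = (\<lambda>n. B * real (Suc n) powr (- (Re x - d) - K))"
    have "summable (\<lambda>n. real (Suc n) powr (- (Re x - d) - K))"
      by (subst summable_Suc_iff[of "\<lambda>n. real n powr (- (Re x - d) - K)"])
         (use d in \<open>simp add: summable_real_powr_iff d_def field_simps\<close>)
    hence h: "summable h" unfolding h_def by (rule summable_mult)
    have h0: "h n \<ge> 0" for n using B by (simp add: h_def)
    show "\<exists>d h. 0 < d \<and> summable h \<and> range h \<subseteq> \<real>\<^sub>\<ge>\<^sub>0 \<and>
            (\<forall>\<^sub>F n in sequentially. \<forall>y\<in>ball x d \<inter> ?S. cmod (f n y) \<le> cmod (h n))"
    proof (intro exI[of _ d] exI[of _ "\<lambda>n. of_real (h n)"] conjI always_eventually allI ballI d)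
      show "summable (\<lambda>n. complex_of_real (h n))"
        using h by (rule summable_of_real)
      show "range (\<lambda>n. complex_of_real (h n)) \<subseteq> \<real>\<^sub>\<ge>\<^sub>0" using h0 by auto
      fix n y assume y: "y \<in> ball x d \<inter> ?S"
      have "Re x - Re y \<le> d"
        using y abs_Re_le_cmod[of "x - y"] by (auto simp: dist_norm)
      hence "real (Suc n) powr (- Re y - K) \<le> real (Suc n) powr (- (Re x - d) - K)"
        by (intro powr_mono) auto
      moreover have "C y \<le> B" using y B by auto
      ultimately have "C y * real (Suc n) powr (- Re y - K) \<le> h n"
        unfolding h_def using B by (intro mult_mono) auto
      thus "cmod (f n y) \<le> cmod (of_real (h n))"
        using bound[of y n] y h0[of n] by auto
    qed
  qed blast
  then obtain g where g: "\<And>x. x \<in> ?S \<Longrightarrow> (\<lambda>n. f n x) sums g x"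
      "\<And>x. x \<in> ?S \<Longrightarrow> g field_differentiable (at x)" by blast
  have "g holomorphic_on ?S"
    using g(2) by (auto simp: holomorphic_on_def field_differentiable_at_within)
  thus "(\<lambda>s. \<Sum>n. f n s) holomorphic_on ?S"
    by (rule holomorphic_transform) (use g(1) in \<open>auto simp: sums_iff\<close>)
  show "summable (\<lambda>n. f n s)" if "Re s > 1 - K"
    using g(1) that by (auto simp: sums_iff)
qed

definition dzeta :: "complex \<Rightarrow> complex" where
  "dzeta s = (\<Sum>n. of_nat (Suc n) powr (-s))"

lemma norm_Suc_powr: "cmod (of_nat (Suc n) powr s) = real (Suc n) powr Re s"
  using norm_powr_real_powr[of "of_nat (Suc n)" s] by (simp add: Re_complex_of_real[symmetric])

lemma dzeta_holomorphic: "dzeta holomorphic_on {s. Re s > 1}"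
  and dzeta_sums: "Re s > 1 \<Longrightarrow> (\<lambda>n. of_nat (Suc n) powr (-s)) sums dzeta s"
proof -
  have hol: "(\<lambda>s. of_nat (Suc n) powr (-s)) holomorphic_on UNIV" for n
    by (intro holomorphic_intros) 
  have b: "cmod (of_nat (Suc n) powr (-s)) \<le> 1 * real (Suc n) powr (- Re s - 0)" for n s
    by (simp only: norm_Suc_powr) simp
  show "dzeta holomorphic_on {s. Re s > 1}"
    using series_holomorphic(1)[of "\<lambda>n s. of_nat (Suc n) powr (-s)" "\<lambda>_. 1" 0, OF hol _ b]
    by (simp add: dzeta_def[abs_def])
  show "(\<lambda>n. of_nat (Suc n) powr (-s)) sums dzeta s" if "Re s > 1"
    using series_holomorphic(2)[of "\<lambda>n s. of_nat (Suc n) powr (-s)" "\<lambda>_. 1" 0, OF hol _ b] that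
    unfolding dzeta_def by (intro summable_sums) auto
qed

definition ffact :: "complex \<Rightarrow> nat \<Rightarrow> complex" where
  "ffact a i = (\<Prod>j<i. a - of_nat j)"

definition zrem :: "nat \<Rightarrow> nat \<Rightarrow> complex \<Rightarrow> complex" where
  "zrem K n s = of_nat (Suc (Suc n)) powr (1 - s)
     - (\<Sum>i\<le>K. ffact (1 - s) i / fact i * of_nat (Suc n) powr (1 - s - of_nat i))"

lemma zrem_bound:
  assumes "Re s > 1 - real K"
  shows "cmod (zrem K n s) \<le> cmod (ffact (1 - s) (Suc K)) * real (Suc n) powr (- Re s - real K)"
proof -
  define a where "a = 1 - s"
  define N where "N = real (Suc n)"
  define f where "f = (\<lambda>i x. ffact a i * x powr (a - of_nat i))"
  define S where "S = closed_segment (complex_of_real N) (of_real (N + 1))"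
  have S: "\<exists>t. N \<le> t \<and> t \<le> N + 1 \<and> x = of_real t" if "x \<in> S" for x
    using that unfolding S_def closed_segment_of_real by (auto simp: closed_segment_eq_real_ivl)
  have N: "N > 0" by (simp add: N_def)
  have "cmod (f 0 (of_real (N+1)) - (\<Sum>i\<le>K. f i (of_real N) * (of_real (N+1) - of_real N) ^ i / fact i))
      \<le> (cmod (ffact a (Suc K)) * N powr (- Re s - real K)) * cmod (of_real (N+1) - of_real N)^(Suc K) / fact K"
  proof (rule complex_Taylor)
    show "convex S" by (simp add: S_def)
    show "complex_of_real N \<in> S" "complex_of_real (N+1) \<in> S" by (simp_all add: S_def)
    fix x assume "x \<in> S"
    then obtain t where t: "N \<le> t" "t \<le> N + 1" "x = of_real t" using S by blast
    have x: "x \<notin> \<real>\<^sub>\<le>\<^sub>0" using t N by auto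
    show "(f i has_field_derivative f (Suc i) x) (at x within S)" for i
      unfolding f_def
      by (rule has_field_derivative_at_within)
         (use x in \<open>auto intro!: derivative_eq_intros simp: ffact_def algebra_simps\<close>)
    have "cmod (x powr (a - of_nat (Suc K))) = t powr (- Re s - real K)"
      using t N by (simp add: norm_powr_real_powr a_def algebra_simps)
    also have "\<dots> \<le> N powr (- Re s - real K)"
      using t N assms by (intro powr_mono2') auto
    finally show "cmod (f (Suc K) x) \<le> cmod (ffact a (Suc K)) * N powr (- Re s - real K)"
      unfolding f_def norm_mult by (rule mult_left_mono) auto
  qed
  also have "\<dots> \<le> cmod (ffact a (Suc K)) * N powr (- Re s - real K)"
  proof -
    have "x / fact K \<le> x" if "x \<ge> 0" for x :: real
      using that fact_ge_1[of K, where ?'a = real] by (simp add: divide_le_eq mult_le_cancel_left1)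
    thus ?thesis by simp
  qed
  also have "f 0 (of_real (N+1)) - (\<Sum>i\<le>K. f i (of_real N) * (of_real (N+1) - of_real N) ^ i / fact i)
      = zrem K n s"
    by (simp add: zrem_def f_def ffact_def a_def N_def add_ac)
  finally show ?thesis by (simp add: a_def N_def)
qed

lemma ffact_holomorphic [holomorphic_intros]:
  "f holomorphic_on S \<Longrightarrow> (\<lambda>s. ffact (f s) i) holomorphic_on S"
  unfolding ffact_def by (intro holomorphic_intros)

lemma zrem_holomorphic: "zrem K n holomorphic_on UNIV"
  unfolding zrem_def[abs_def] by (intro holomorphic_intros) (auto simp: )

lemma zrem_sum_holomorphic: "(\<lambda>s. \<Sum>n. zrem K n s) holomorphic_on {s. Re s > 1 - real K}"
proof (rule series_holomorphic(1))
  show "zrem K n holomorphic_on UNIV" for n by (rule zrem_holomorphic)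
  show "continuous_on UNIV (\<lambda>s. cmod (ffact (1 - s) (Suc K)))"
    unfolding ffact_def by (intro continuous_intros)
qed (rule zrem_bound)

lemma dzeta_recurrence:
  assumes s: "Re s > 1"
  shows "(s - 1) * dzeta s = 1 + (\<Sum>n. zrem (Suc M) n s)
     - (\<Sum>j<M. ffact (1 - s) (Suc j) / fact (j + 2) * ((s + of_nat (Suc j) - 1) * dzeta (s + of_nat (Suc j))))"
proof -
  define a where "a = 1 - s"
  have lim: "(\<lambda>n. complex_of_nat (Suc n) powr a) \<longlonglongrightarrow> 0"
  proof (rule tendsto_norm_zero_cancel)
    have "(\<lambda>n. real (Suc n) powr Re a) \<longlonglongrightarrow> 0"
      using s by (intro tendsto_neg_powr filterlim_compose[OF filterlim_real_sequentially filterlim_Suc])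
                 (auto simp: a_def)
    thus "(\<lambda>n. cmod (of_nat (Suc n) powr a)) \<longlonglongrightarrow> 0" by (simp only: norm_Suc_powr)
  qed
  have t1: "(\<lambda>n. of_nat (Suc (Suc n)) powr a - of_nat (Suc n) powr a) sums (0 - 1)"
    using telescope_sums[OF lim] by simp
  have t2: "(\<lambda>n. \<Sum>i<Suc M. ffact a (Suc i) / fact (Suc i) * of_nat (Suc n) powr (-(s + of_nat i)))
      sums (\<Sum>i<Suc M. ffact a (Suc i) / fact (Suc i) * dzeta (s + of_nat i))"
    using s by (intro sums_sum sums_mult dzeta_sums) auto
  have e: "zrem (Suc M) n s = (of_nat (Suc (Suc n)) powr a - of_nat (Suc n) powr a)
     - (\<Sum>i<Suc M. ffact a (Suc i) / fact (Suc i) * of_nat (Suc n) powr (-(s + of_nat i)))" for n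
  proof -
    have "(\<Sum>i\<le>Suc M. ffact (1 - s) i / fact i * of_nat (Suc n) powr (1 - s - of_nat i))
       = of_nat (Suc n) powr a
          + (\<Sum>i\<le>M. ffact a (Suc i) / fact (Suc i) * of_nat (Suc n) powr (1 - s - of_nat (Suc i)))"
      by (subst sum.atMost_Suc_shift) (simp add: a_def ffact_def)
    also have "(\<lambda>i. 1 - s - of_nat (Suc i)) = (\<lambda>i. -(s + of_nat i))" by (auto simp: fun_eq_iff)
    finally show ?thesis
      by (simp add: zrem_def a_def lessThan_Suc_atMost algebra_simps)
  qed
  have "(\<lambda>n. zrem (Suc M) n s) sums
      ((0 - 1) - (\<Sum>i<Suc M. ffact a (Suc i) / fact (Suc i) * dzeta (s + of_nat i)))"
    unfolding e by (intro sums_diff t1 t2)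
  hence "(\<Sum>n. zrem (Suc M) n s) =
      - 1 - (\<Sum>i<Suc M. ffact a (Suc i) / fact (Suc i) * dzeta (s + of_nat i))"
    by (simp add: sums_iff)
  also have "(\<Sum>i<Suc M. ffact a (Suc i) / fact (Suc i) * dzeta (s + of_nat i)) =
      - ((s - 1) * dzeta s) + (\<Sum>j<M. ffact a (Suc (Suc j)) / fact (Suc (Suc j)) * dzeta (s + of_nat (Suc j)))"
    by (subst sum.lessThan_Suc_shift) (simp add: ffact_def a_def algebra_simps)
  also have "(\<Sum>j<M. ffact a (Suc (Suc j)) / fact (Suc (Suc j)) * dzeta (s + of_nat (Suc j))) =
      - (\<Sum>j<M. ffact a (Suc j) / fact (j + 2) * ((s + of_nat (Suc j) - 1) * dzeta (s + of_nat (Suc j))))"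
    unfolding sum_negf[symmetric]
  proof (rule sum.cong)
    fix j
    have "ffact a (Suc (Suc j)) = - (ffact a (Suc j) * (s + of_nat (Suc j) - 1))"
      by (simp add: ffact_def a_def algebra_simps)
    thus "ffact a (Suc (Suc j)) / fact (Suc (Suc j)) * dzeta (s + of_nat (Suc j)) =
      - (ffact a (Suc j) / fact (j + 2) * ((s + of_nat (Suc j) - 1) * dzeta (s + of_nat (Suc j))))"
      by (simp del: fact_Suc)
  qed simp
  finally show ?thesis by (simp add: a_def algebra_simps)
qed

lemma zeta_continuation_halfplane:
  "\<exists>E. E holomorphic_on {s. Re s > 1 - real m} \<and> (\<forall>s. Re s > 1 \<longrightarrow> E s = (s - 1) * dzeta s)"
proof (induction m)
  case 0
  show ?case
    by (rule exI[of _ "\<lambda>s. (s - 1) * dzeta s"]) (auto intro!: holomorphic_intros dzeta_holomorphic)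
next
  case (Suc m)
  then obtain E where E: "E holomorphic_on {s. Re s > 1 - real m}"
    "\<And>s. Re s > 1 \<Longrightarrow> E s = (s - 1) * dzeta s" by blast
  define E' where "E' = (\<lambda>s. 1 + (\<Sum>n. zrem (Suc m) n s)
     - (\<Sum>j<m. ffact (1 - s) (Suc j) / fact (j + 2) * E (s + of_nat (Suc j))))"
  have shift: "(\<lambda>s. E (s + of_nat (Suc j))) holomorphic_on {s. Re s > 1 - real (Suc m)}" for j
    by (rule holomorphic_on_compose_gen[OF _ E(1), unfolded o_def])
       (auto intro!: holomorphic_intros)
  have "E' holomorphic_on {s. Re s > 1 - real (Suc m)}"
    unfolding E'_def by (intro holomorphic_intros zrem_sum_holomorphic shift) auto
  moreover have "E' s = (s - 1) * dzeta s" if "Re s > 1" for s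
    unfolding dzeta_recurrence[OF that, of m] E'_def using that by (simp add: E(2))
  ultimately show ?case by blast
qed

lemma is_zeta_exists: "\<exists>f. is_zeta f"
proof -
  let ?H = "\<lambda>m. {s. Re s > 1 - real m}"
  obtain E where E: "\<And>m. E m holomorphic_on ?H m"
    "\<And>m s. Re s > 1 \<Longrightarrow> E m s = (s - 1) * dzeta s"
    using zeta_continuation_halfplane by metis
  have agree: "E m s = E k s" if "m \<le> k" "s \<in> ?H m" for m k s
  proof -
    have hol: "(\<lambda>s. E m s - E k s) holomorphic_on ?H m"
      using that(1) by (intro holomorphic_intros E(1) holomorphic_on_subset[OF E(1)[of k]]) auto
    have lim: "(2::complex) islimpt {w. Re w > 1}"
      by (rule interior_limit_point) (simp add: interior_open open_halfspace_Re_gt)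
    have "E m s - E k s = 0"
    proof (rule analytic_continuation[OF hol _ _ _ _ lim])
      show "connected (?H m)" by (intro convex_connected convex_halfspace_Re_gt)
      show "open (?H m)" by (rule open_halfspace_Re_gt)
    qed (use that(2) E(2) in auto)
    thus ?thesis by simp
  qed
  define F where "F = (\<lambda>s. E (nat \<lceil>2 - Re s\<rceil>) s)"
  have F: "F s = E m s" if "s \<in> ?H m" for m s
  proof -
    have s: "s \<in> ?H (nat \<lceil>2 - Re s\<rceil>)" 
      by simp linarith
    show ?thesis
    proof (cases "m \<le> nat \<lceil>2 - Re s\<rceil>")
      case True thus ?thesis using agree[OF True that] by (simp add: F_def)
    next
      case False show ?thesis unfolding F_def
        by (rule agree[OF _ s]) (use False in linarith)
    qed
  qed
  have "F holomorphic_on UNIV"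
  proof -
    have "F holomorphic_on (\<Union>m. ?H m)"
    proof (rule holomorphic_on_UN_open)
      show "F holomorphic_on ?H m" for m
        by (rule holomorphic_transform[OF E(1)]) (use F in auto)
    qed (rule open_halfspace_Re_gt)
    moreover have "s \<in> (\<Union>m. ?H m)" for s :: complex
    proof -
      obtain m where "1 - Re s < real m" using reals_Archimedean2 by blast
      thus ?thesis by (auto intro!: exI[of _ m])
    qed
    ultimately show ?thesis by (metis UNIV_eq_I)
  qed
  hence "(\<lambda>s. F s / (s - 1)) holomorphic_on (-{1})"
    by (intro holomorphic_intros) (auto intro: holomorphic_on_subset)
  moreover have "(\<lambda>n. 1 / of_nat (Suc n) powr s) sums (F s / (s - 1))" if "Re s > 1" for s
  proof -
    have "F s = (s - 1) * dzeta s" using F[of s 0] E(2)[of s 0] that by simp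
    moreover have "s \<noteq> 1" using that by auto
    ultimately show ?thesis using dzeta_sums[OF that] by (simp add: powr_minus_divide)
  qed
  ultimately show ?thesis unfolding is_zeta_def by blast
qed

lemma is_zeta_zeta: "is_zeta zeta"
  unfolding zeta_def using is_zeta_exists by (rule someI_ex)

end

theory Submission
  imports Defs
begin

text \<open>
  Write \<open>M(N)\<close> for the sum of \<open>\<mu>(j)\<close> over \<open>j \<le> N\<close>. The exponential sum has derivative at most \<open>N\<^sup>2\<close>,
  so it stays above \<open>|M(N)| / 2\<close> on an arc of length about \<open>N\<^sup>-\<^sup>2\<close> around \<open>1\<close>; a bound on the
  \<open>L\<^sup>p\<close> norms therefore gives \<open>M(N) = O(N\<^bsup>1/2 + 2/p\<^esup>)\<close>. With \<open>p\<close> arbitrarily large, partial summation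
  continues \<open>1/\<zeta>\<close> holomorphically to \<open>Re s > 1/2\<close>, so \<open>\<zeta>\<close> has no zeros there.

  The zeros with \<open>Re s < 1/2\<close> are excluded by the functional equation. For \<open>0 < r < 1\<close>, the value
  \<open>-\<zeta>(-r)\<close> is the sum of the errors of the trapezoidal rule for \<open>t\<^sup>r\<close> on \<open>[n, n + 1]\<close>, \<open>n \<ge> 0\<close>.
  Writing \<open>t\<^bsup>r-2\<^esup>\<close> as a Gamma integral and summing over \<open>n\<close> turns it into an integral against
  \<open>coth(x/2)/2 - 1/x\<close>, whose partial fraction expansion yields \<open>\<zeta>(1 + r)\<close> term by term. All
  integrands are nonnegative, so every interchange is an instance of Tonelli's theorem.
\<close>

section \<open>From \<open>L\<^sup>p\<close> norms to summatory functions\<close>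

lemma norm_cis_minus_one_le: "norm (cis t - 1) \<le> \<bar>t\<bar>"
proof -
  have "norm (cis t - 1) = 2 * \<bar>sin (t / 2)\<bar>"
    using dist_exp_i_1[of t] by (simp add: cis_conv_exp)
  thus ?thesis using abs_sin_x_le_abs_x[of "t/2"] by simp
qed

text \<open>Integrating the p-th power of the lower bound \<open>c\<close> over an arc of angle
  \<open>\<delta>\<close> and taking p-th roots gives the estimate. The normalized measure of the
  arc is 1/(4 pi N^2), whence the factor \<open>(4 * pi) powr (1 / p)\<close> and the exponent 2/p;
  the exponent 1/2 undoes the normalization.\<close>

lemma sum_le_Lp_norm_exp_sum:
  fixes a :: "nat \<Rightarrow> int"
  assumes a: "\<And>j. \<bar>a j\<bar> \<le> 1" and p: "p > 0" and N: "N \<ge> 1"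
  shows "real_of_int \<bar>\<Sum>j=1..N. a j\<bar>
           \<le> 2 * (4 * pi) powr (1 / p) * Lp_norm p circle_measure (normalized_exp_sum a N) * real N powr (1 / 2 + 2 / p)"
proof (cases "(\<Sum>j=1..N. a j) = 0")
  case True
  thus ?thesis by (simp add: Lp_norm_def)
next
  case False
  define S where "S = real_of_int \<bar>\<Sum>j=1..N. a j\<bar>"
  \<comment> \<open>Each of the N terms moves by at most N t when z goes from 1 to
    \<open>cis t\<close>, so this choice limits the total change to N^2 \<open>\<delta>\<close> =
    1/2.\<close>
  define \<delta> where "\<delta> = 1 / (2 * real N ^ 2)"
  define P where "P = normalized_exp_sum a N"
  define c where "c = S / (2 * sqrt (real N))"
  \<comment> \<open>A nonzero integer has absolute value at least 1, so the change of 1/2 costs at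
    most half of \<open>S\<close>.\<close>
  have S1: "S \<ge> 1" using False unfolding S_def by linarith
  have N0: "real N > 0" using N by simp
  have "1 \<le> real N ^ 2" using N by (intro one_le_power) simp
  hence "1 / (2 * real N ^ 2) \<le> 1 / 1" by (intro frac_le) linarith+
  hence \<delta>: "\<delta> > 0" "\<delta> \<le> 1" using N0 by (simp_all add: \<delta>_def)
  have c0: "c > 0" using S1 N0 by (simp add: c_def)
  have [measurable]: "P \<in> borel_measurable borel"
    unfolding P_def normalized_exp_sum_def by (intro borel_measurable_continuous_onI continuous_intros)
  have contP: "continuous_on A (\<lambda>t. norm (P (cis t)) powr p)" for A
    unfolding P_def normalized_exp_sum_def by (intro continuous_intros continuous_on_powr') (use p in auto)
  have low: "norm (P (cis t)) \<ge> c" if t: "t \<in> {0..\<delta>}" for t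
  proof -
    have "norm ((\<Sum>j=1..N. of_int (a j) * cis t ^ j) - (\<Sum>j=1..N. complex_of_int (a j)))
        = norm (\<Sum>j=1..N. of_int (a j) * (cis t ^ j - 1))"
      by (simp add: sum_subtractf algebra_simps)
    also have "\<dots> \<le> (\<Sum>j=1..N. real N * t)"
    proof (rule sum_norm_le)
      fix j assume j: "j \<in> {1..N}"
      have "norm (of_int (a j) * (cis t ^ j - 1)) = real_of_int \<bar>a j\<bar> * norm (cis (real j * t) - 1)"
        by (simp add: norm_mult Complex.DeMoivre)
      also have "\<dots> \<le> 1 * \<bar>real j * t\<bar>"
        using a[of j] by (intro mult_mono norm_cis_minus_one_le) auto
      also have "\<dots> \<le> real N * t" using j t by (auto simp: abs_mult intro!: mult_right_mono)
      finally show "norm (of_int (a j) * (cis t ^ j - 1)) \<le> real N * t" .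
    qed
    also have "\<dots> = real N ^ 2 * t" by (simp add: power2_eq_square)
    also have "\<dots> \<le> real N ^ 2 * \<delta>" using t by (intro mult_left_mono) auto
    also have "\<dots> = 1 / 2" using N0 by (simp add: \<delta>_def)
    also have "\<dots> \<le> S / 2" using S1 by simp
    finally have "norm ((\<Sum>j=1..N. of_int (a j) * cis t ^ j) - (\<Sum>j=1..N. complex_of_int (a j))) \<le> S / 2" .
    moreover have "norm (\<Sum>j=1..N. complex_of_int (a j)) = S"
      unfolding S_def by (simp flip: of_int_sum)
    ultimately have "S / 2 \<le> norm (\<Sum>j=1..N. of_int (a j) * cis t ^ j)"
      using norm_triangle_ineq3[of "\<Sum>j=1..N. complex_of_int (a j)" "\<Sum>j=1..N. of_int (a j) * cis t ^ j"]
      by (simp add: norm_minus_commute)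
    thus ?thesis using N0
      by (simp add: P_def normalized_exp_sum_def c_def norm_mult norm_divide field_simps)
  qed
  have "\<delta> * c powr p = (LINT t|lborel. indicator {0..\<delta>} t *\<^sub>R c powr p)"
    using \<delta> by simp
  also have "\<dots> \<le> (LINT t:{0..2*pi}|lborel. norm (P (cis t)) powr p)"
    unfolding set_lebesgue_integral_def
  proof (rule integral_mono)
    show "integrable lborel (\<lambda>t. indicator {0..\<delta>} t *\<^sub>R c powr p)"
      by (intro integrable_scaleR_left integrable_real_indicator) (auto simp: emeasure_lborel_Icc_eq)
    show "integrable lborel (\<lambda>t. indicator {0..2*pi} t *\<^sub>R norm (P (cis t)) powr p)"
      using borel_integrable_compact[OF compact_Icc contP] .
    fix t :: real
    show "indicator {0..\<delta>} t *\<^sub>R c powr p \<le> indicator {0..2*pi} t *\<^sub>R norm (P (cis t)) powr p"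
    proof (cases "t \<in> {0..\<delta>}")
      case True
      moreover have "t \<in> {0..2*pi}" using True \<delta> pi_gt3 by auto
      ultimately show ?thesis using low[OF True] c0 p by (auto intro!: powr_mono2)
    qed (auto simp: indicator_def)
  qed
  finally have "1 / (2 * pi) * (\<delta> * c powr p) \<le> integral\<^sup>L circle_measure (\<lambda>z. norm (P z) powr p)"
    by (subst integral_circle_measure) (auto simp: field_simps)
  hence "(1 / (2 * pi) * (\<delta> * c powr p)) powr (1 / p) \<le> Lp_norm p circle_measure P"
    unfolding Lp_norm_def using p \<delta> by (intro powr_mono2) auto
  also have "(1 / (2 * pi) * (\<delta> * c powr p)) powr (1 / p) = (1 / (4 * pi * real N ^ 2)) powr (1 / p) * c"
    using c0 \<delta> p by (subst mult.assoc[symmetric], subst powr_mult) (auto simp: powr_powr \<delta>_def mult.assoc)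
  also have "\<dots> = c / ((4 * pi) powr (1/p) * real N powr (2 / p))"
    using N0 by (simp add: powr_divide powr_mult powr_powr flip: powr_numeral)
  finally have "c \<le> (4 * pi) powr (1/p) * real N powr (2 / p) * Lp_norm p circle_measure P"
    using N0 by (simp add: field_simps)
  hence "S \<le> 2 * real N powr (1/2) * ((4 * pi) powr (1/p) * real N powr (2 / p) * Lp_norm p circle_measure P)"
    using N0 by (simp add: c_def field_simps powr_half_sqrt)
  thus ?thesis by (simp add: S_def P_def powr_add mult_ac)
qed

section \<open>Summatory bounds and zeros of the zeta function\<close>

lemma abs_moebius_mu_le: "\<bar>moebius_mu n\<bar> \<le> 1"
  by (simp add: moebius_mu_def liouville_def)

lemma moebius_mu_1 [simp]: "moebius_mu (Suc 0) = 1"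
  by (simp add: moebius_mu_def liouville_def)

lemma moebius_mu_prime_mult:
  assumes "prime p" "\<not> p dvd e"
  shows "moebius_mu (p * e) = - moebius_mu e"
proof -
  have cop: "coprime p e" using assms by (simp add: prime_imp_coprime)
  have e0: "e \<noteq> 0" using assms(2) by (metis dvd_0_right)
  have "squarefree (p * e) \<longleftrightarrow> squarefree e"
    using squarefree_mult_coprime[OF cop] squarefree_multD[of p e] squarefree_prime[OF assms(1)] by blast
  moreover have "liouville (p * e) = - liouville e"
    unfolding liouville_def using assms(1) e0
    by (subst prime_factorization_mult) (auto simp: prime_factorization_prime)
  ultimately show ?thesis by (simp add: moebius_mu_def)
qed

text \<open>Fix a prime p dividing n. Multiplication by p sends the divisors prime to p injectively
  to divisors divisible by p and flips the sign of the Mobius function, so these contributions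
  cancel. The divisors outside the image are divisible by p^2 and contribute 0.\<close>

lemma sum_moebius_mu_divisors:
  assumes n: "n > 0"
  shows "(\<Sum>d | d dvd n. moebius_mu d) = (if n = 1 then 1 else 0)"
proof (cases "n = 1")
  case False
  then obtain p where p: "prime p" "p dvd n" using prime_factor_nat by blast
  define A where "A = {d. d dvd n \<and> \<not> p dvd d}"
  define B where "B = {d. d dvd n \<and> p dvd d}"
  have fin: "finite A" "finite B" unfolding A_def B_def using n by auto
  have sub: "(\<lambda>e. p * e) ` A \<subseteq> B"
  proof -
    have "p * e dvd n" if "e dvd n" "\<not> p dvd e" for e
      using p that by (intro divides_mult) (auto simp: prime_imp_coprime)
    thus ?thesis unfolding A_def B_def by (blast intro: dvd_triv_left)
  qed
  have zero: "moebius_mu d = 0" if "d \<in> B - (\<lambda>e. p * e) ` A" for d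
  proof -
    from that obtain e where e: "d = p * e" "d dvd n" by (auto simp: B_def)
    have "e dvd n" using e by (metis dvd_mult_right)
    with that e have "p dvd e" by (auto simp: A_def)
    hence "p ^ 2 dvd d" using e by (simp add: power2_eq_square)
    hence "\<not> squarefree d" using p(1) squarefreeD by (metis not_prime_unit)
    thus ?thesis by (simp add: moebius_mu_def)
  qed
  have "(\<Sum>d | d dvd n. moebius_mu d) = sum moebius_mu A + sum moebius_mu B"
    using fin by (subst sum.union_disjoint[symmetric]) (auto simp: A_def B_def intro!: sum.cong)
  also have "sum moebius_mu B = sum moebius_mu ((\<lambda>e. p * e) ` A)"
    by (rule sum.mono_neutral_right) (use fin sub zero in auto)
  also have "\<dots> = (\<Sum>e\<in>A. - moebius_mu e)"
    using p(1) by (subst sum.reindex) (auto simp: inj_on_def A_def moebius_mu_prime_mult intro!: sum.cong)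
  finally show ?thesis using False by (simp add: sum_negf)
qed simp

lemma zeta_eq_dzeta:
  assumes "Re s > 1"
  shows "zeta s = dzeta s"
proof -
  have "(\<lambda>n. of_nat (Suc n) powr (-s)) sums zeta s"
    using is_zeta_zeta assms by (simp add: is_zeta_def powr_minus_divide)
  thus ?thesis using dzeta_sums[OF assms] by (rule sums_unique2)
qed

text \<open>Absolute convergence allows the product of the two Dirichlet series to be regrouped by n
  = d m. The coefficient of n^(-s) is then the divisor sum of the Mobius function, which leaves only
  n = 1.\<close>

lemma dzeta_times_moebius_series:
  assumes s: "Re s > 1"
    and D: "(\<lambda>n. of_int (moebius_mu (Suc n)) * of_nat (Suc n) powr (-s)) sums D"
  shows "dzeta s * D = 1"
proof -
  define f where "f = (\<lambda>d. of_int (moebius_mu d) * of_nat d powr (-s) :: complex)"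
  define g where "g = (\<lambda>m. of_nat m powr (-s) :: complex)"
  define A where "A = {0::nat<..}"
  have bij: "bij_betw Suc UNIV A"
    unfolding A_def by (rule bij_betwI[of _ _ _ "\<lambda>n. n - 1"]) auto
  have sm: "summable (\<lambda>n. real (Suc n) powr (- Re s))"
    by (subst summable_Suc_iff[of "\<lambda>n. real n powr (- Re s)"]) (use s in \<open>simp add: summable_real_powr_iff\<close>)
  have norm_g: "norm (g (Suc n)) = real (Suc n) powr (- Re s)" for n
    unfolding g_def norm_Suc_powr by simp
  have norm_f: "norm (f (Suc n)) \<le> real (Suc n) powr (- Re s)" for n
    using abs_moebius_mu_le[of "Suc n"] norm_g[of n] mult_right_mono[of "\<bar>real_of_int (moebius_mu (Suc n))\<bar>" 1 "norm (g (Suc n))"]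
    by (simp add: f_def g_def norm_mult del: of_nat_Suc)
  have sf: "summable (\<lambda>n. norm (f (Suc n)))"
    by (rule summable_comparison_test'[OF sm, of 0]) (use norm_f in auto)
  have sg: "summable (\<lambda>n. norm (g (Suc n)))" unfolding norm_g by (rule sm)
  have hf: "(f has_sum D) A"
    using norm_summable_imp_has_sum[OF sf] D has_sum_reindex_bij_betw[OF bij, of f] by (simp add: f_def)
  have hg: "(g has_sum dzeta s) A"
    using norm_summable_imp_has_sum[OF sg] dzeta_sums[OF s] has_sum_reindex_bij_betw[OF bij, of g] by (simp add: g_def)
  have af: "(\<lambda>x. norm (f x)) summable_on A"
    using norm_summable_imp_summable_on[of "\<lambda>n. norm (f (Suc n))"] sf
      summable_on_reindex_bij_betw[OF bij, of "\<lambda>x. norm (f x)"] by simp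
  have ag: "(\<lambda>x. norm (g x)) summable_on A"
    using norm_summable_imp_summable_on[of "\<lambda>n. norm (g (Suc n))"] sg
      summable_on_reindex_bij_betw[OF bij, of "\<lambda>x. norm (g x)"] by simp
  have abs: "(\<lambda>x. norm ((\<lambda>(d,m). f d * g m) x)) summable_on (A \<times> A)"
    unfolding Infinite_Sum.abs_summable_on_Sigma_iff
    using af ag by (auto simp: norm_mult infsum_cmult_right' abs_mult intro!: summable_on_cmult_left summable_on_cmult_right)
  have "D * dzeta s = infsum f A * infsum g A"
    using hf hg by (simp add: infsumI)
  also have "\<dots> = infsum (\<lambda>d. infsum (\<lambda>m. f d * g m) A) A"
    by (simp add: infsum_cmult_left' infsum_cmult_right')
  also have "\<dots> = infsum (\<lambda>(d,m). f d * g m) (A \<times> A)"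
    by (rule infsum_Sigma'_banach) (use abs Infinite_Sum.abs_summable_summable in auto)
  \<comment> \<open>The pair (d, m) of positive integers corresponds to (d m, d), a positive integer
    together with one of its divisors.\<close>
  also have "\<dots> = infsum (\<lambda>(n,d). f d * g (n div d)) (Sigma A (\<lambda>n. {d. d dvd n}))"
    by (rule infsum_reindex_bij_witness[of _ "\<lambda>(n,d). (d, n div d)" "\<lambda>(d,m). (d * m, d)"])
       (auto simp: A_def)
  also have "\<dots> = infsum (\<lambda>n. infsum (\<lambda>d. f d * g (n div d)) {d. d dvd n}) A"
  proof (rule infsum_Sigma'_banach[symmetric])
    have "(\<lambda>(d,m). f d * g m) summable_on (A \<times> A)"
      using abs Infinite_Sum.abs_summable_summable by auto
    also have "?this \<longleftrightarrow> (\<lambda>(n,d). f d * g (n div d)) summable_on (Sigma A (\<lambda>n. {d. d dvd n}))"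
      by (rule summable_on_reindex_bij_witness[of _ "\<lambda>(n,d). (d, n div d)" "\<lambda>(d,m). (d * m, d)"])
         (auto simp: A_def)
    finally show "(\<lambda>(n,d). f d * g (n div d)) summable_on (Sigma A (\<lambda>n. {d. d dvd n}))" .
  qed
  also have "\<dots> = infsum (\<lambda>n. if n = 1 then 1 else 0) A"
  proof (rule infsum_cong)
    fix n assume n: "n \<in> A"
    have "infsum (\<lambda>d. f d * g (n div d)) {d. d dvd n} = (\<Sum>d | d dvd n. f d * g (n div d))"
      using n by (intro infsum_finite) (auto simp: A_def)
    also have "\<dots> = (\<Sum>d | d dvd n. of_int (moebius_mu d) * g n)"
    proof (rule sum.cong)
      fix d assume "d \<in> {d. d dvd n}"
      then obtain k where k: "n = d * k" by auto
      hence "d > 0" using n by (auto simp: A_def)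
      thus "f d * g (n div d) = of_int (moebius_mu d) * g n"
        using k powr_times_real[of "of_nat d" "of_nat k" "-s"] by (simp add: f_def g_def)
    qed simp
    also have "\<dots> = of_int (\<Sum>d | d dvd n. moebius_mu d) * g n"
      by (simp add: sum_distrib_right)
    also have "\<dots> = (if n = 1 then 1 else 0)"
      using n by (subst sum_moebius_mu_divisors) (auto simp: A_def g_def)
    finally show "infsum (\<lambda>d. f d * g (n div d)) {d. d dvd n} = (if n = 1 then 1 else 0)" .
  qed
  also have "\<dots> = infsum (\<lambda>n. 1) {1::nat}"
    by (rule infsum_cong_neutral) (auto simp: A_def)
  finally show ?thesis by (simp add: mult.commute)
qed

text \<open>Partial summation turns the Mobius series into a series \<open>F\<close> in M(n) (n^(-s)
  - (n+1)^(-s)), which under the bound is holomorphic for Re s > \<open>\<beta>\<close>. The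
  identity zeta F = 1, known for large Re s, extends by analytic continuation and excludes
  zeros.\<close>

lemma zeta_nonzero_of_mertens_bound:
  assumes bound: "\<And>N. N \<ge> 1 \<Longrightarrow> real_of_int \<bar>\<Sum>j=1..N. moebius_mu j\<bar> \<le> C * real N powr \<beta>"
    and \<beta>: "\<beta> > 0" and s: "Re s > \<beta>" "s \<noteq> 1"
  shows "zeta s \<noteq> 0"
proof -
  define M where "M = (\<lambda>N. \<Sum>j=1..N. moebius_mu j)"
  define f where "f = (\<lambda>n s. of_int (M (Suc n)) * (of_nat (Suc n) powr (-s) - of_nat (Suc (Suc n)) powr (-s)) :: complex)"
  define F where "F = (\<lambda>s. \<Sum>n. f n s)"
  let ?S = "{s. Re s > \<beta>}"
  have bd: "cmod (f n s) \<le> C * cmod s * real (Suc n) powr (- Re s - (1 - \<beta>))" if "Re s > \<beta>" for n s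
  proof -
    \<comment> \<open>At order 0 and argument s + 1 the Taylor remainder is exactly the difference
      of consecutive powers with exponent -s.\<close>
    have "cmod (zrem 0 n (s+1)) \<le> cmod (ffact (1 - (s+1)) (Suc 0)) * real (Suc n) powr (- Re (s+1) - real 0)"
      using that \<beta> by (intro zrem_bound) auto
    hence z: "cmod (of_nat (Suc n) powr (-s) - of_nat (Suc (Suc n)) powr (-s)) \<le> cmod s * real (Suc n) powr (- Re s - 1)"
      by (subst norm_minus_commute) (simp add: zrem_def ffact_def del: of_nat_Suc, simp only: of_nat_Suc[of 0] of_nat_0 add_0_right mult_1 of_nat_1)
    have "cmod (of_int (M (Suc n))) \<le> C * real (Suc n) powr \<beta>"
      using bound[of "Suc n"] unfolding M_def norm_of_int by simp
    hence "cmod (f n s) \<le> (C * real (Suc n) powr \<beta>) * (cmod s * real (Suc n) powr (- Re s - 1))"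
      unfolding f_def norm_mult
      by (intro mult_mono z) (auto intro: order_trans[OF norm_ge_zero])
    also have "\<dots> = C * cmod s * (real (Suc n) powr \<beta> * real (Suc n) powr (- Re s - 1))" by simp
    also have "real (Suc n) powr \<beta> * real (Suc n) powr (- Re s - 1) = real (Suc n) powr (- Re s - (1 - \<beta>))"
      by (subst powr_add[symmetric]) (simp add: algebra_simps)
    finally show ?thesis .
  qed
  have hol: "f n holomorphic_on UNIV" for n
    unfolding f_def by (intro holomorphic_intros)
  have cont: "continuous_on UNIV (\<lambda>s. C * cmod s)" by (intro continuous_intros)
  have F_hol: "F holomorphic_on ?S"
    using series_holomorphic(1)[of f "\<lambda>s. C * cmod s" "1 - \<beta>", OF hol cont] bd
    unfolding F_def by simp
  have F_summable: "summable (\<lambda>n. f n s)" if "Re s > \<beta>" for s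
    using series_holomorphic(2)[of f "\<lambda>s. C * cmod s" "1 - \<beta>", OF hol cont, of s] bd that by simp
  have eq: "zeta s * F s = 1" if s: "Re s > 1" "Re s > \<beta>" for s
  proof -
    have abel: "(\<Sum>n<N. f n s) = (\<Sum>n<N. of_int (moebius_mu (Suc n)) * of_nat (Suc n) powr (-s))
                  - of_int (M N) * of_nat (Suc N) powr (-s)" for N
      by (induction N) (simp_all add: f_def M_def algebra_simps del: of_nat_Suc)
    \<comment> \<open>For Re s > 1 this trivial bound already makes the boundary term of the partial
      summation vanish.\<close>
    have M_le: "\<bar>real_of_int (M N)\<bar> \<le> real N" for N
      using sum_norm_bound[of "{1..N}" "\<lambda>j. real_of_int (moebius_mu j)" 1] abs_moebius_mu_le
      by (simp add: M_def flip: of_int_abs)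
    have lim: "(\<lambda>N. of_int (M N) * of_nat (Suc N) powr (-s)) \<longlonglongrightarrow> 0"
    proof (rule Lim_null_comparison)
      show "\<forall>\<^sub>F N in sequentially. norm (of_int (M N) * complex_of_nat (Suc N) powr (-s)) \<le> real (Suc N) powr (1 - Re s)"
      proof (intro always_eventually allI)
        fix N
        have "norm (of_int (M N) * complex_of_nat (Suc N) powr (-s)) \<le> real (Suc N) * real (Suc N) powr (- Re s)"
          unfolding norm_mult norm_Suc_powr using M_le[of N] by (intro mult_mono) auto
        also have "\<dots> = real (Suc N) powr (1 - Re s)" by (simp add: powr_diff powr_minus_divide)
        finally show "norm (of_int (M N) * complex_of_nat (Suc N) powr (-s)) \<le> real (Suc N) powr (1 - Re s)" .
      qed
      show "(\<lambda>N. real (Suc N) powr (1 - Re s)) \<longlonglongrightarrow> 0"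
        using s by (intro tendsto_neg_powr filterlim_compose[OF filterlim_real_sequentially filterlim_Suc]) auto
    qed
    have "(\<lambda>N. (\<Sum>n<N. f n s) + of_int (M N) * of_nat (Suc N) powr (-s)) \<longlonglongrightarrow> F s + 0"
      using F_summable[OF s(2)] lim unfolding F_def by (intro tendsto_add summable_LIMSEQ)
    hence "(\<lambda>n. of_int (moebius_mu (Suc n)) * of_nat (Suc n) powr (-s)) sums F s"
      unfolding abel sums_def by simp
    from dzeta_times_moebius_series[OF s(1) this] show ?thesis
      by (simp add: zeta_eq_dzeta s)
  qed
  \<comment> \<open>A point in both half-planes, since \<open>\<beta>\<close> may exceed 1.\<close>
  define x where "x = (of_real (max 1 \<beta> + 1) :: complex)"
  have "zeta s * F s - 1 = 0"
  proof (rule analytic_continuation[where f = "\<lambda>s. zeta s * F s - 1" and S = "?S - {1}" and U = "{s. Re s > 1} \<inter> ?S" and \<xi> = x])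
    show "(\<lambda>s. zeta s * F s - 1) holomorphic_on ?S - {1}"
      using is_zeta_zeta by (auto simp: is_zeta_def intro!: holomorphic_intros
        intro: holomorphic_on_subset holomorphic_on_subset[OF F_hol])
    show "open (?S - {1})" by (intro open_delete open_halfspace_Re_gt)
    show "connected (?S - {1})"
      by (intro connected_open_delete open_halfspace_Re_gt convex_connected convex_halfspace_Re_gt) simp
    show "x islimpt {s. Re s > 1} \<inter> ?S"
      by (rule interior_limit_point)
         (auto simp: interior_open open_halfspace_Re_gt open_Int x_def)
    show "x \<in> ?S - {1}" by (auto simp: x_def complex_eq_iff)
  qed (use s eq in auto)
  thus ?thesis by auto
qed

section \<open>Partial fractions of the hyperbolic cotangent\<close>

text \<open>Differentiating the reflection formula rGamma(z) rGamma(1 - z) = sin(pi z)/pi expresses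
  pi cot(pi z) as a difference of Digamma values, and the Digamma series can be subtracted
  termwise.\<close>

lemma cot_partial_fractions:
  fixes z :: complex
  assumes z: "z \<notin> \<int>"
  shows "(\<lambda>k. 2 * z / (z ^ 2 - of_nat (Suc k) ^ 2)) sums
           (of_real pi * cos (of_real pi * z) / sin (of_real pi * z) - 1 / z)"
proof -
  have z0: "z \<noteq> 0" using z by auto
  have nz: "z \<notin> \<int>\<^sub>\<le>\<^sub>0" using z nonpos_Ints_Int by blast
  have "1 - z \<notin> \<int>" using z by (metis Ints_1 Ints_diff diff_diff_eq2 add_diff_cancel_left')
  hence nz': "1 - z \<notin> \<int>\<^sub>\<le>\<^sub>0" using nonpos_Ints_Int by blast
  have sin: "sin (of_real pi * z) \<noteq> 0"
    using z by (auto simp: sin_eq_0 mult.commute[of _ "of_real pi"])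
  have d1: "((\<lambda>z. rGamma z * rGamma (1 - z)) has_field_derivative
      rGamma z * rGamma (1 - z) * (Digamma (1 - z) - Digamma z)) (at z)"
    using nz nz' by (auto intro!: derivative_eq_intros simp: algebra_simps)
  have d2: "((\<lambda>z. sin (of_real pi * z) / of_real pi) has_field_derivative cos (of_real pi * z)) (at z)"
    by (auto intro!: derivative_eq_intros)
  have "rGamma z * rGamma (1 - z) * (Digamma (1 - z) - Digamma z) = cos (of_real pi * z)"
    using d1 d2 unfolding rGamma_reflection_complex by (rule DERIV_unique)
  hence "Digamma (1 - z) - Digamma z = of_real pi * cos (of_real pi * z) / sin (of_real pi * z)"
    unfolding rGamma_reflection_complex using sin by (simp add: field_simps)
  \<comment> \<open>Moving from z to 1 + z splits off the term 1/z and makes the two series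
    symmetric under z -> -z.\<close>
  moreover have "Digamma (1 + z) = Digamma z + 1 / z"
    using Digamma_plus1[OF z0] by (simp add: add.commute)
  ultimately have val: "Digamma (1 - z) - Digamma (1 + z) =
      of_real pi * cos (of_real pi * z) / sin (of_real pi * z) - 1 / z" by simp
  have psi: "(\<lambda>k. inverse (of_nat (Suc k)) - inverse (w + of_nat k)) sums (Digamma w + euler_mascheroni)"
    if "w \<noteq> 0" for w :: complex
    using summable_sums[OF summable_Digamma[OF that]] by (simp add: Digamma_def)
  have nonz: "1 - z + of_nat k \<noteq> 0" "1 + z + of_nat k \<noteq> 0" for k
  proof -
    have "z \<noteq> of_int (1 + int k)" "z \<noteq> of_int (- 1 - int k)" using z by auto
    thus "1 - z + of_nat k \<noteq> 0" "1 + z + of_nat k \<noteq> 0"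
      by (auto simp: algebra_simps eq_neg_iff_add_eq_0)
  qed
  have "(\<lambda>k. (inverse (of_nat (Suc k)) - inverse (1 - z + of_nat k)) - (inverse (of_nat (Suc k)) - inverse (1 + z + of_nat k)))
      sums ((Digamma (1 - z) + euler_mascheroni) - (Digamma (1 + z) + euler_mascheroni))"
    using nonz[of 0] by (intro sums_diff psi) auto
  also have "(\<lambda>k. (inverse (of_nat (Suc k)) - inverse (1 - z + of_nat k)) - (inverse (of_nat (Suc k)) - inverse (1 + z + of_nat k)))
      = (\<lambda>k. 2 * z / (z ^ 2 - of_nat (Suc k) ^ 2))"
  proof
    fix k
    define a b where "a = 1 - z + of_nat k" and "b = 1 + z + of_nat k"
    have ab: "a \<noteq> 0" "b \<noteq> 0" using nonz[of k] by (auto simp: a_def b_def)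
    have "z ^ 2 - of_nat (Suc k) ^ 2 = - (a * b)"
      by (simp add: a_def b_def power2_eq_square algebra_simps)
    moreover have "2 * z = b - a" by (simp add: a_def b_def)
    moreover have "inverse b - inverse a = (b - a) / (- (a * b))" using ab by (simp add: field_simps)
    ultimately have "inverse (1 + z + of_nat k) - inverse (1 - z + of_nat k) = 2 * z / (z ^ 2 - of_nat (Suc k) ^ 2)"
      by (simp only: a_def b_def)
    thus "(inverse (of_nat (Suc k)) - inverse (1 - z + of_nat k)) - (inverse (of_nat (Suc k)) - inverse (1 + z + of_nat k))
        = 2 * z / (z ^ 2 - of_nat (Suc k) ^ 2)" by (simp del: of_nat_Suc)
  qed
  finally show ?thesis using val by simp
qed

text \<open>The cotangent expansion at z = i x/(2 pi). The value is coth(x/2)/2 - 1/x, written in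
  exp(-x) so that it matches the geometric series arising from the trapezoidal errors.\<close>

lemma coth_partial_fractions:
  fixes x :: real
  assumes x: "x > 0"
  shows "(\<lambda>m. 2 * x / (x ^ 2 + (2 * pi * real (Suc m)) ^ 2)) sums
           ((1 + exp (- x)) / (2 * (1 - exp (- x))) - 1 / x)"
proof -
  define y where "y = x / (2 * pi)"
  define z where "z = \<i> * of_real y"
  have y: "y > 0" using x by (simp add: y_def)
  have "z \<notin> \<int>" using y by (auto simp: z_def complex_eq_iff elim!: Ints_cases)
  from cot_partial_fractions[OF this]
  have s: "(\<lambda>k. 2 * z / (z ^ 2 - of_nat (Suc k) ^ 2)) sums
           (of_real pi * cos (of_real pi * z) / sin (of_real pi * z) - 1 / z)" .
  define q where "q = exp (- x)"
  have q: "q > 0" "q < 1" using x by (auto simp: q_def)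
  have e1: "exp (\<i> * (of_real pi * z)) = of_real (exp (- x / 2))"
    unfolding exp_of_real[symmetric] by (rule arg_cong[where f = exp]) (simp add: z_def y_def field_simps)
  have e2: "exp (- (\<i> * (of_real pi * z))) = of_real (exp (x / 2))"
    unfolding exp_of_real[symmetric] by (rule arg_cong[where f = exp]) (simp add: z_def y_def field_simps)
  have q2: "exp (- x / 2) = q * exp (x / 2)"
    unfolding q_def by (simp flip: exp_add)
  have cs: "cos (of_real pi * z) = of_real ((1 + q) * exp (x / 2) / 2)"
    unfolding cos_exp_eq e1 e2 q2 by (simp add: algebra_simps)
  have sn: "sin (of_real pi * z) = \<i> * of_real ((1 - q) * exp (x / 2) / 2)"
    unfolding sin_exp_eq e1 e2 q2 by (simp add: field_simps)
  have c: "of_real pi * cos (of_real pi * z) / sin (of_real pi * z) - 1 / z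
      = - \<i> * of_real (2 * pi * ((1 + q) / (2 * (1 - q)) - 1 / x))"
  proof -
    define e where "e = complex_of_real (exp (x / 2))"
    have "of_real pi * cos (of_real pi * z) / sin (of_real pi * z) =
        (of_real pi * (of_real (1 + q) * e / 2)) / (\<i> * (of_real (1 - q) * e / 2))"
      unfolding cs sn by (simp add: e_def)
    also have "\<dots> = - \<i> * (of_real pi * (of_real (1 + q) / of_real (1 - q)))"
      by (simp add: e_def divide_simps)
    also have "of_real pi * (of_real (1 + q) / of_real (1 - q)) = complex_of_real (2 * pi * ((1 + q) / (2 * (1 - q))))"
      unfolding of_real_divide[symmetric] of_real_mult[symmetric] using q by (simp add: divide_simps)
    finally have "of_real pi * cos (of_real pi * z) / sin (of_real pi * z) =
        - \<i> * of_real (2 * pi * ((1 + q) / (2 * (1 - q))))" .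
    moreover have "1 / z = - \<i> * of_real (2 * pi * (1 / x))"
      using x by (simp add: z_def y_def divide_simps)
    ultimately show ?thesis unfolding right_diff_distrib of_real_diff by simp
  qed
  have t: "2 * z / (z ^ 2 - of_nat (Suc k) ^ 2) =
      - \<i> * of_real (2 * pi * (2 * x / (x ^ 2 + (2 * pi * real (Suc k)) ^ 2)))" for k
  proof -
    define D where "D = y ^ 2 + real (Suc k) ^ 2"
    have eq: "z ^ 2 - of_nat (Suc k) ^ 2 = - of_real D"
      by (simp add: z_def D_def power_mult_distrib)
    have "2 * z / (z ^ 2 - of_nat (Suc k) ^ 2) = - \<i> * of_real (2 * y / D)"
      unfolding eq by (simp add: z_def)
    also have "2 * y / D = 2 * pi * (2 * x / (x ^ 2 + (2 * pi * real (Suc k)) ^ 2))"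
    proof -
      have x: "x = 2 * pi * y" by (simp add: y_def)
      have "x ^ 2 + (2 * pi * real (Suc k)) ^ 2 = (2 * pi) ^ 2 * D"
        by (simp only: x D_def power_mult_distrib distrib_left)
      thus ?thesis unfolding x by (simp add: power2_eq_square)
    qed
    finally show ?thesis .
  qed
  \<comment> \<open>Terms and value are all -i times a real number; multiplication by i brings the
    statement down to the reals.\<close>
  have "(\<lambda>k. of_real (2 * pi * (2 * x / (x ^ 2 + (2 * pi * real (Suc k)) ^ 2))) :: complex) sums
      of_real (2 * pi * ((1 + q) / (2 * (1 - q)) - 1 / x))"
    using sums_mult[OF s[unfolded t c], of \<i>] by simp
  hence "(\<lambda>k. 2 * pi * (2 * x / (x ^ 2 + (2 * pi * real (Suc k)) ^ 2))) sums
      (2 * pi * ((1 + q) / (2 * (1 - q)) - 1 / x))"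
    unfolding sums_of_real_iff .
  from sums_divide[OF this, of "2 * pi"] show ?thesis
    unfolding q_def by (subst (asm) (1 2) nonzero_mult_div_cancel_left) auto
qed

section \<open>The zeta function and the trapezoidal rule\<close>

lemma zrem_sum_summable:
  assumes "Re s > 1 - real K"
  shows "summable (\<lambda>n. zrem K n s)"
proof (rule series_holomorphic(2)[OF _ _ _ assms])
  show "zrem K n holomorphic_on UNIV" for n by (rule zrem_holomorphic)
  show "continuous_on UNIV (\<lambda>s. cmod (ffact (1 - s) (Suc K)))"
    unfolding ffact_def by (intro continuous_intros)
qed (rule zrem_bound)

text \<open>The summands are, up to the factor \<open>s - 1\<close>, the errors of the trapezoidal rule for
  \<open>t\<^sup>-\<^sup>s\<close> on the unit intervals.\<close>

lemma zeta_trapezoidal: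
  assumes s: "Re s > -1" "s \<noteq> 1"
  shows "(\<lambda>n. zrem 2 n s + (s - 1) / 2 * zrem 1 n (s + 1)) sums ((s - 1) * zeta s - (s + 1) / 2)"
proof -
  let ?S = "{s. Re s > -1} :: complex set"
  define E where "E = (\<lambda>s. (\<Sum>n. zrem 2 n s) + (s - 1) / 2 * (\<Sum>n. zrem 1 n (s + 1)))"
  have "(\<lambda>s. \<Sum>n. zrem 2 n s) holomorphic_on ?S"
    using zrem_sum_holomorphic[of 2] by simp
  moreover have "(\<lambda>s. \<Sum>n. zrem 1 n (s + 1)) holomorphic_on ?S"
    by (rule holomorphic_on_compose_gen[OF _ zrem_sum_holomorphic[of 1], unfolded o_def])
       (auto intro!: holomorphic_intros)
  ultimately have hol: "E holomorphic_on ?S"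
    unfolding E_def by (intro holomorphic_intros) auto
  \<comment> \<open>The recurrence at s with one correction term and at s + 1 with none allows
    dzeta(s + 1) to be eliminated, leaving only remainder sums and 1 - (1 - s)/2 = (s + 1)/2. Both
    remainder sums converge for Re s > -1.\<close>
  have eq: "(s - 1) * zeta s - (s + 1) / 2 - E s = 0" if "Re s > 1" for s
  proof -
    have "(s - 1) * dzeta s = 1 + (\<Sum>n. zrem 2 n s) - (1 - s) / 2 * (s * dzeta (s + 1))"
      using dzeta_recurrence[OF that, of 1] by (simp add: ffact_def numeral_2_eq_2)
    moreover have "s * dzeta (s + 1) = 1 + (\<Sum>n. zrem 1 n (s + 1))"
      using dzeta_recurrence[of "s + 1" 0] that by simp
    ultimately have "(s - 1) * dzeta s = 1 + (\<Sum>n. zrem 2 n s) - (1 - s) / 2 * (1 + (\<Sum>n. zrem 1 n (s + 1)))"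
      by (simp only:)
    thus ?thesis unfolding zeta_eq_dzeta[OF that] E_def by (simp only:) (simp add: field_simps)
  qed
  have "(s - 1) * zeta s - (s + 1) / 2 - E s = 0"
  proof (rule analytic_continuation[where f = "\<lambda>s. (s - 1) * zeta s - (s + 1) / 2 - E s" and S = "?S - {1}" and U = "{s. Re s > 1}" and \<xi> = 2])
    show "(\<lambda>s. (s - 1) * zeta s - (s + 1) / 2 - E s) holomorphic_on ?S - {1}"
      using is_zeta_zeta by (auto simp: is_zeta_def intro!: holomorphic_intros
        intro: holomorphic_on_subset holomorphic_on_subset[OF hol])
    show "open (?S - {1})" by (intro open_delete open_halfspace_Re_gt)
    show "connected (?S - {1})"
      by (intro connected_open_delete open_halfspace_Re_gt convex_connected convex_halfspace_Re_gt) simp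
    show "2 islimpt {s. Re s > 1}"
      by (rule interior_limit_point) (simp add: interior_open open_halfspace_Re_gt)
  qed (use s eq in auto)
  moreover have "(\<lambda>n. zrem 2 n s + (s - 1) / 2 * zrem 1 n (s + 1)) sums E s"
    unfolding E_def using s
    by (intro sums_add sums_mult summable_sums zrem_sum_summable) auto
  ultimately show ?thesis by simp
qed

section \<open>Values of zeta at 0 and on the interval (-1, 0)\<close>

lemma zrem_1_eq:
  "zrem 1 n s = of_nat (Suc (Suc n)) powr (1 - s) - of_nat (Suc n) powr (1 - s)
     - (1 - s) * of_nat (Suc n) powr (-s)"
proof -
  define x y where "x = complex_of_nat (Suc n)" and "y = complex_of_nat (Suc (Suc n))"
  have "(\<Sum>i\<le>1. f i) = f 0 + f 1" for f :: "nat \<Rightarrow> complex" by simp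
  moreover have "ffact a 0 = 1" "ffact a 1 = a" for a by (simp_all add: ffact_def)
  ultimately show ?thesis unfolding zrem_def x_def[symmetric] y_def[symmetric] by simp
qed

lemma zrem_2_eq:
  "zrem 2 n s = of_nat (Suc (Suc n)) powr (1 - s) - of_nat (Suc n) powr (1 - s)
     - (1 - s) * of_nat (Suc n) powr (-s) - (1 - s) * (- s) / 2 * of_nat (Suc n) powr (-s - 1)"
proof -
  define x y where "x = complex_of_nat (Suc n)" and "y = complex_of_nat (Suc (Suc n))"
  have "(\<Sum>i\<le>2. f i) = f 0 + f 1 + f 2" for f :: "nat \<Rightarrow> complex" by (simp add: numeral_2_eq_2)
  moreover have "ffact a 0 = 1" "ffact a 1 = a" "ffact a 2 = a * (a - 1)" for a
    by (simp_all add: ffact_def numeral_2_eq_2)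
  moreover have e: "- s - 1 = - 1 - s" by simp
  ultimately show ?thesis unfolding zrem_def x_def[symmetric] y_def[symmetric] e by simp
qed

text \<open>The trapezoidal rule is exact for the constant t^0, so every summand vanishes at s = 0.
  This value settles the point s = 0, whose reflection 1 is excluded from the functional
  equation.\<close>

lemma zeta_0: "zeta 0 = - 1 / 2"
proof -
  have "zrem 2 n 0 = 0" "zrem 1 n 1 = 0" for n
    using of_nat_neq_0[of n, where 'a = complex] of_nat_neq_0[of "Suc n", where 'a = complex]
    unfolding zrem_1_eq zrem_2_eq by simp_all
  with zeta_trapezoidal[of 0] have "(\<lambda>n. 0) sums (- zeta 0 - 1 / 2)" by simp
  hence "- zeta 0 - 1 / 2 = 0" using sums_unique2 sums_zero by blast
  hence "- zeta 0 = 1 / 2" by simp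
  thus ?thesis by (metis minus_divide_left minus_minus)
qed

text \<open>The exact integral of t^r over [n, n + 1] minus its trapezoidal approximation.\<close>

definition trapezoid_defect :: "real \<Rightarrow> nat \<Rightarrow> real" where
  "trapezoid_defect r n = (real (Suc n) powr (r + 1) - real n powr (r + 1)) / (r + 1)
     - (real n powr r + real (Suc n) powr r) / 2"

text \<open>At s = -r the summands of \<open>zeta_trapezoidal\<close> are r + 1 times the defects on
  [n + 1, n + 2]. After division by r + 1 the elementary term (s + 1)/2 becomes the defect on
  [0, 1], which completes the series.\<close>

lemma trapezoid_defect_sums:
  assumes r: "0 < r" "r < 1"
  shows "(\<lambda>n. complex_of_real (trapezoid_defect r n)) sums (- zeta (- of_real r))"
proof -
  define s where "s = - complex_of_real r"
  have summand: "zrem 2 n s + (s - 1) / 2 * zrem 1 n (s + 1) = of_real ((r + 1) * trapezoid_defect r (Suc n))" for n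
  proof -
    have pow: "complex_of_nat (Suc k) powr (of_real x) = of_real (real (Suc k) powr x)" for k x
      by (simp add: powr_of_real[symmetric] del: of_nat_Suc)
    have "zrem 2 n s = of_real (real (Suc (Suc n)) powr (r + 1) - real (Suc n) powr (r + 1)
       - (r + 1) * real (Suc n) powr r - (r + 1) * r / 2 * real (Suc n) powr (r - 1))"
      using pow[of "Suc n" "1 + r"] pow[of "n" "1 + r"] pow[of "n" r] pow[of "n" "r - 1"]
      by (simp add: zrem_2_eq s_def algebra_simps del: of_nat_Suc)
    moreover have "zrem 1 n (s + 1) = of_real (real (Suc (Suc n)) powr r - real (Suc n) powr r
       - r * real (Suc n) powr (r - 1))"
      using pow[of "Suc n" r] pow[of n r] pow[of n "r - 1"]
      by (subst zrem_1_eq) (simp add: s_def algebra_simps del: of_nat_Suc)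
    moreover have "(s - 1) / 2 = of_real (- (r + 1) / 2)" by (simp add: s_def)
    ultimately have "zrem 2 n s + (s - 1) / 2 * zrem 1 n (s + 1) = of_real
      (real (Suc (Suc n)) powr (r + 1) - real (Suc n) powr (r + 1)
       - (r + 1) * real (Suc n) powr r - (r + 1) * r / 2 * real (Suc n) powr (r - 1)
       + (- (r + 1) / 2) * (real (Suc (Suc n)) powr r - real (Suc n) powr r - r * real (Suc n) powr (r - 1)))"
      by (simp only: of_real_add of_real_mult)
    also have "\<dots> = of_real ((r + 1) * trapezoid_defect r (Suc n))"
      using r by (intro arg_cong[where f = of_real]) (simp add: trapezoid_defect_def field_simps del: of_nat_Suc)
    finally show ?thesis .
  qed
  have "s \<noteq> 1" "Re s > -1" using r by (auto simp: s_def complex_eq_iff)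
  from zeta_trapezoidal[OF this(2,1)]
  have "(\<lambda>n. of_real ((r + 1) * trapezoid_defect r (Suc n))) sums ((s - 1) * zeta s - (s + 1) / 2)"
    unfolding summand .
  moreover have "complex_of_real ((r + 1) * t) / of_real (r + 1) = of_real t" for t
    using r unfolding of_real_divide[symmetric] by simp
  ultimately have "(\<lambda>n. complex_of_real (trapezoid_defect r (Suc n))) sums (((s - 1) * zeta s - (s + 1) / 2) / of_real (r + 1))"
    using sums_divide[of _ _ "of_real (r + 1)"] by (metis (no_types, lifting) sums_cong)
  moreover have "((s - 1) * zeta s - (s + 1) / 2) / of_real (r + 1) = - zeta s - of_real (trapezoid_defect r 0)"
  proof -
    define d where "d = complex_of_real (r + 1)"
    have d: "d \<noteq> 0" using r unfolding d_def by (simp only: of_real_eq_0_iff)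
    have s1: "s = 1 - d" and T: "of_real (trapezoid_defect r 0) = 1 / d - 1 / 2"
      using r by (simp_all add: s_def d_def trapezoid_defect_def)
    define Z where "Z = zeta s"
    show ?thesis
      unfolding d_def[symmetric] Z_def[symmetric] T unfolding s1 using d by (simp add: field_simps)
  qed
  ultimately show ?thesis
    using sums_Suc_iff[of "\<lambda>n. complex_of_real (trapezoid_defect r n)"] by (simp add: s_def)
qed

section \<open>Integral representation of the trapezoidal errors\<close>

text \<open>Substitute t = v x^r in Euler's integral for Gamma(a/r). The case r = 1 represents
  powers as Laplace integrals, the case r = 2 gives Gaussian moments.\<close>

lemma Gamma_integral_exp_powr:
  fixes a v r :: real
  assumes a: "a > 0" and v: "v > 0" and r: "r > 0"
  shows "((\<lambda>x. x powr (a - 1) * exp (- v * x powr r)) has_integral (Gamma (a / r) * v powr (- a / r) / r)) {0<..}"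
proof -
  define b where "b = a / r"
  have b: "b > 0" "r * b = a" using a r by (auto simp: b_def)
  define f where "f = (\<lambda>t. t powr (b - 1) / exp t)"
  define g where "g = (\<lambda>x. v * x powr r)"
  have "(f has_integral Gamma b) {0..}" unfolding f_def by (rule Gamma_integral_real[OF b(1)])
  hence I: "(f has_integral Gamma b) {0<..}"
    by (subst (asm) has_integral_spike_set_eq[where T = "{0<..}"]) (auto intro: negligible_subset[of "{0::real}"])
  have f_abs: "f absolutely_integrable_on {0<..}" "integral {0<..} f = Gamma b"
    using I by (auto simp: f_def integral_unique intro!: nonnegative_absolutely_integrable_1)
  have img: "g ` {0<..} = {0<..}"
  proof (intro equalityI subsetI)
    fix y :: real assume "y \<in> {0<..}"
    hence "y = g ((y / v) powr (1 / r))" "(y / v) powr (1 / r) \<in> {0<..}"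
      using v r by (auto simp: g_def powr_powr)
    thus "y \<in> g ` {0<..}" by blast
  qed (use v in \<open>auto simp: g_def\<close>)
  have inj: "inj_on g {0<..}"
    by (rule inj_on_inverseI[where g = "\<lambda>y. (y / v) powr (1 / r)"]) (use v r in \<open>auto simp: g_def powr_powr\<close>)
  have A: "(\<lambda>x. \<bar>v * (r * x powr (r - 1))\<bar> * f (g x)) absolutely_integrable_on {0<..} \<and>
        integral {0<..} (\<lambda>x. \<bar>v * (r * x powr (r - 1))\<bar> * f (g x)) = Gamma b"
  proof (rule has_absolute_integral_change_of_variables_1'[of "{0<..}" g "\<lambda>x. v * (r * x powr (r - 1))" f "Gamma b", THEN iffD2])
    show "(g has_real_derivative v * (r * x powr (r - 1))) (at x within {0<..})" if "x \<in> {0<..}" for x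
      unfolding g_def using that by (auto intro!: derivative_eq_intros)
  qed (use img inj f_abs in auto)
  have "((\<lambda>x. \<bar>v * (r * x powr (r - 1))\<bar> * f (g x)) has_integral Gamma b) {0<..}"
    using integrable_integral[OF set_lebesgue_integral_eq_integral(1)[OF conjunct1[OF A]]]
    unfolding conjunct2[OF A] .
  hence "((\<lambda>x. \<bar>v * (r * x powr (r - 1))\<bar> * f (g x) / (r * v powr b)) has_integral (Gamma b / (r * v powr b))) {0<..}"
    by (rule has_integral_divide)
  hence "((\<lambda>x. x powr (a - 1) * exp (- v * x powr r)) has_integral (Gamma b / (r * v powr b))) {0<..}"
  proof (rule has_integral_eq[rotated])
    fix x :: real assume x: "x \<in> {0<..}"
    have e1: "(v * x powr r) powr (b - 1) = v powr b / v * x powr (a - r)"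
      using x v b by (simp add: powr_mult powr_powr powr_diff algebra_simps)
    have e2: "x powr (r - 1) * x powr (a - r) = x powr (a - 1)"
      by (simp flip: powr_add)
    have "\<bar>v * (r * x powr (r - 1))\<bar> * f (g x) / (r * v powr b)
        = (x powr (r - 1) * x powr (a - r)) * exp (- v * x powr r)"
      unfolding f_def g_def e1 using v r x by (simp add: exp_minus field_simps)
    thus "\<bar>v * (r * x powr (r - 1))\<bar> * f (g x) / (r * v powr b) = x powr (a - 1) * exp (- v * x powr r)"
      unfolding e2 .
  qed
  thus ?thesis by (simp add: b_def powr_minus field_simps)
qed

lemma nn_integral_exp_powr:
  fixes a v r :: real
  assumes "a > 0" "v > 0" "r > 0"
  shows "(\<integral>\<^sup>+x. ennreal (x powr (a - 1) * exp (- v * x powr r)) * indicator {0<..} x \<partial>lborel)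
           = ennreal (Gamma (a / r) * v powr (- a / r) / r)"
  by (rule nn_integral_has_integral_lebesgue'[OF _ Gamma_integral_exp_powr[OF assms]]) auto

lemma nn_integral_powr_exp:
  fixes a v :: real
  assumes "a > 0" "v > 0"
  shows "(\<integral>\<^sup>+x. ennreal (x powr (a - 1) * exp (- v * x)) * indicator {0<..} x \<partial>lborel)
           = ennreal (Gamma a * v powr (- a))"
proof -
  have "(\<integral>\<^sup>+x. ennreal (x powr (a - 1) * exp (- v * x)) * indicator {0<..} x \<partial>lborel)
      = (\<integral>\<^sup>+x. ennreal (x powr (a - 1) * exp (- v * x powr 1)) * indicator {0<..} x \<partial>lborel)"
    by (intro nn_integral_cong) (auto simp: indicator_def)
  thus ?thesis using nn_integral_exp_powr[OF assms, of 1] by simp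
qed

text \<open>Write 1/(x^2 + a^2) as the integral of exp(-v (x^2 + a^2)) over v > 0 and interchange.
  The x-integral is a Gaussian moment, and the remaining v-integral is again a Gamma
  integral.\<close>

lemma nn_integral_powr_over_sum_squares:
  fixes a r :: real
  assumes r: "0 < r" "r < 1" and a: "a > 0"
  shows "(\<integral>\<^sup>+x. ennreal (2 * x powr (- r) / (x ^ 2 + a ^ 2)) * indicator {0<..} x \<partial>lborel)
           = ennreal (Gamma ((1 - r) / 2) * Gamma ((1 + r) / 2) * a powr (- 1 - r))"
proof -
  define b where "b = (1 - r) / 2"
  have b: "b > 0" "b < 1" "Gamma b > 0" using r by (auto simp: b_def)
  have "(\<integral>\<^sup>+x. ennreal (2 * x powr (- r) / (x ^ 2 + a ^ 2)) * indicator {0<..} x \<partial>lborel) =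
    (\<integral>\<^sup>+x. \<integral>\<^sup>+v. ennreal (2 * x powr (- r) * exp (- v * (x ^ 2 + a ^ 2))) * indicator {0<..} v * indicator {0<..} x \<partial>lborel \<partial>lborel)"
  proof (intro nn_integral_cong)
    fix x :: real
    show "ennreal (2 * x powr (- r) / (x ^ 2 + a ^ 2)) * indicator {0<..} x =
      (\<integral>\<^sup>+v. ennreal (2 * x powr (- r) * exp (- v * (x ^ 2 + a ^ 2))) * indicator {0<..} v * indicator {0<..} x \<partial>lborel)"
    proof (cases "x > 0")
      case True
      have pos: "x ^ 2 + a ^ 2 > 0" using True by (intro add_pos_nonneg) auto
      have "(\<integral>\<^sup>+v. ennreal (2 * x powr (- r) * exp (- v * (x ^ 2 + a ^ 2))) * indicator {0<..} v * indicator {0<..} x \<partial>lborel)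
         = (\<integral>\<^sup>+v. ennreal (2 * x powr (- r)) * (ennreal (v powr (1 - 1) * exp (- (x ^ 2 + a ^ 2) * v)) * indicator {0<..} v) \<partial>lborel)"
        using True by (intro nn_integral_cong) (auto simp: indicator_def ennreal_mult'[symmetric] algebra_simps)
      also have "\<dots> = ennreal (2 * x powr (- r)) * ennreal (Gamma 1 * (x ^ 2 + a ^ 2) powr (- 1))"
        using nn_integral_powr_exp[OF zero_less_one pos] by (subst nn_integral_cmult) auto
      also have "\<dots> = ennreal (2 * x powr (- r) / (x ^ 2 + a ^ 2))"
        using pos by (simp add: ennreal_mult'[symmetric] powr_minus_divide)
      finally show ?thesis using True by simp
    qed simp
  qed
  also have "\<dots> = (\<integral>\<^sup>+v. \<integral>\<^sup>+x. ennreal (2 * x powr (- r) * exp (- v * (x ^ 2 + a ^ 2))) * indicator {0<..} v * indicator {0<..} x \<partial>lborel \<partial>lborel)"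
    by (rule lborel_pair.Fubini') measurable
  also have "\<dots> = (\<integral>\<^sup>+v. ennreal (Gamma b) * (ennreal (v powr ((1 - b) - 1) * exp (- (a ^ 2) * v)) * indicator {0<..} v) \<partial>lborel)"
  proof (intro nn_integral_cong)
    fix v :: real
    show "(\<integral>\<^sup>+x. ennreal (2 * x powr (- r) * exp (- v * (x ^ 2 + a ^ 2))) * indicator {0<..} v * indicator {0<..} x \<partial>lborel) =
       ennreal (Gamma b) * (ennreal (v powr ((1 - b) - 1) * exp (- (a ^ 2) * v)) * indicator {0<..} v)"
    proof (cases "v > 0")
      case True
      have "(\<integral>\<^sup>+x. ennreal (2 * x powr (- r) * exp (- v * (x ^ 2 + a ^ 2))) * indicator {0<..} v * indicator {0<..} x \<partial>lborel) =
        (\<integral>\<^sup>+x. ennreal (2 * exp (- (a ^ 2) * v)) * (ennreal (x powr ((1 - r) - 1) * exp (- v * x powr 2)) * indicator {0<..} x) \<partial>lborel)"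
        using True by (intro nn_integral_cong)
          (auto simp: indicator_def ennreal_mult'[symmetric] exp_add[symmetric] algebra_simps)
      also have "\<dots> = ennreal (2 * exp (- (a ^ 2) * v)) * ennreal (Gamma ((1 - r) / 2) * v powr (- (1 - r) / 2) / 2)"
        using nn_integral_exp_powr[of "1 - r" v 2] True r by (subst nn_integral_cmult) auto
      also have "\<dots> = ennreal (Gamma b) * ennreal (v powr ((1 - b) - 1) * exp (- (a ^ 2) * v))"
      proof -
        have "(1 - r) / 2 = b" "- (1 - r) / 2 = (1 - b) - 1" by (simp_all add: b_def field_simps)
        thus ?thesis using b by (simp only:) (simp add: ennreal_mult'[symmetric] mult_ac)
      qed
      finally show ?thesis using True by simp
    qed simp
  qed
  also have "\<dots> = ennreal (Gamma b) * ennreal (Gamma (1 - b) * (a ^ 2) powr (- (1 - b)))"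
    using nn_integral_powr_exp[of "1 - b" "a ^ 2"] a b by (subst nn_integral_cmult) auto
  also have "\<dots> = ennreal (Gamma b * Gamma (1 - b) * a powr (- 1 - r))"
  proof -
    have "(a ^ 2) powr (- (1 - b)) = a powr (- 1 - r)"
    proof -
      have "2 * (- (1 - b)) = - 1 - r" by (simp add: b_def field_simps)
      thus ?thesis using a powr_powr[of a 2 "- (1 - b)"] by simp
    qed
    thus ?thesis using b by (simp add: ennreal_mult'[symmetric] mult_ac)
  qed
  also have "1 - b = (1 + r) / 2" by (simp add: b_def field_simps)
  finally show ?thesis by (simp add: b_def)
qed

text \<open>The quadratic factor is the Peano kernel of the trapezoidal rule, the remaining factor the
  negated second derivative of \<open>t\<^sup>r\<close>.\<close>

lemma trapezoid_defect_has_integral: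
  assumes r: "0 < r" "r < 1"
  shows "((\<lambda>t. r * (1 - r) * ((t - real n) * (real (Suc n) - t) / 2) * t powr (r - 2))
           has_integral trapezoid_defect r n) {real n..real (Suc n)}"
proof -
  define m where "m = real n"
  \<comment> \<open>Termwise antiderivative after expanding (t - m)(m + 1 - t) = -t^2 + (2m + 1) t -
    m(m + 1).\<close>
  define F where "F = (\<lambda>t. r * (1 - r) / 2 * (- (t powr (r + 1)) / (r + 1) + (2 * m + 1) * (t powr r / r)
     - m * (m + 1) * (t powr (r - 1) / (r - 1))))"
  have m: "m \<ge> 0" by (simp add: m_def)
  have "((\<lambda>t. r * (1 - r) * ((t - m) * (m + 1 - t) / 2) * t powr (r - 2)) has_integral (F (m + 1) - F m)) {m..m + 1}"
  \<comment> \<open>Differentiability is claimed only in the interior, because for m = 0 the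
    integrand is singular at t = 0.\<close>
  proof (rule fundamental_theorem_of_calculus_interior)
    \<comment> \<open>The exponent r - 1 is negative, so for m = 0 continuity at the left endpoint
      rests on the coefficient m(m + 1) being 0.\<close>
    have c1: "continuous_on {m..m+1} (\<lambda>t. m * (m + 1) * (t powr (r - 1) / (r - 1)))"
    proof (cases "m = 0")
      case False
      thus ?thesis using m r by (intro continuous_intros) auto
    qed simp
    have c2: "continuous_on {m..m+1} (\<lambda>t. t powr q)" if "q > 0" for q
      using m that by (intro continuous_on_powr' continuous_intros) auto
    have "continuous_on {m..m+1} (\<lambda>t. - (t powr (r + 1)) / (r + 1) + (2 * m + 1) * (t powr r / r))"
      using r by (intro continuous_on_add continuous_on_minus continuous_on_divide continuous_on_mult
        continuous_on_const c2) auto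
    from continuous_on_mult[OF continuous_on_const continuous_on_diff[OF this c1]]
    show "continuous_on {m..m+1} F" unfolding F_def .
  next
    fix t assume t: "t \<in> {m<..<m+1}"
    hence t0: "t > 0" using m by auto
    have "(F has_real_derivative r * (1 - r) / 2 * (- (t powr r) + (2 * m + 1) * t powr (r - 1)
        - m * (m + 1) * t powr (r - 1 - 1))) (at t)"
    proof -
      have pw: "((\<lambda>t. t powr p) has_real_derivative p * t powr (p - 1)) (at t)" for p
        using t0 by (auto intro!: derivative_eq_intros)
      have "(F has_real_derivative r * (1 - r) / 2 * (- ((r + 1) * t powr (r + 1 - 1)) / (r + 1)
          + (2 * m + 1) * (r * t powr (r - 1) / r) - m * (m + 1) * ((r - 1) * t powr (r - 1 - 1) / (r - 1)))) (at t)"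
        unfolding F_def
        by (intro DERIV_cmult DERIV_diff DERIV_add DERIV_minus DERIV_cdivide pw)
      moreover have "- ((r + 1) * t powr (r + 1 - 1)) / (r + 1) = - (t powr r)"
        "r * t powr (r - 1) / r = t powr (r - 1)"
        "(r - 1) * t powr (r - 1 - 1) / (r - 1) = t powr (r - 1 - 1)"
        using r by (simp_all add: divide_simps)
      ultimately show ?thesis by (simp only:)
    qed
    moreover have "t powr r = t ^ 2 * t powr (r - 2)" "t powr (r - 1) = t * t powr (r - 2)" "r - 1 - 1 = r - 2"
      using t0 by (simp_all add: powr_diff power2_eq_square)
    ultimately have "(F has_real_derivative r * (1 - r) / 2 * (- (t ^ 2 * t powr (r - 2)) + (2 * m + 1) * (t * t powr (r - 2))
        - m * (m + 1) * t powr (r - 2))) (at t)" by (simp only:)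
    moreover have "r * (1 - r) / 2 * (- (t ^ 2 * t powr (r - 2)) + (2 * m + 1) * (t * t powr (r - 2))
        - m * (m + 1) * t powr (r - 2)) = r * (1 - r) * ((t - m) * (m + 1 - t) / 2) * t powr (r - 2)"
      by (simp add: field_simps power2_eq_square)
    ultimately show "(F has_vector_derivative r * (1 - r) * ((t - m) * (m + 1 - t) / 2) * t powr (r - 2)) (at t)"
      by (simp only: has_real_derivative_iff_has_vector_derivative)
  qed simp
  moreover have "F (m + 1) - F m = trapezoid_defect r n"
  proof -
    define A B where "A = (m + 1) powr r" and "B = m powr r"
    have "(m + 1) powr (r + 1) = (m + 1) * A" "(m + 1) * (m + 1) powr (r - 1) = A"
      using m by (simp_all add: A_def powr_add powr_diff)
    moreover have "m powr (r + 1) = m * B" "m * m powr (r - 1) = B"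
      using m by (cases "m = 0"; simp add: B_def powr_add powr_diff)+
    ultimately have pw: "(m + 1) powr (r + 1) = (m + 1) * A" "m * (m + 1) * (m + 1) powr (r - 1) = m * A"
      "m powr (r + 1) = m * B" "m * (m + 1) * m powr (r - 1) = (m + 1) * B"
      by (simp_all only: mult.assoc mult.left_commute[of m "m + 1"])
    have F1: "F (m + 1) = r * (1 - r) / 2 * (- ((m + 1) * A) / (r + 1) + (2 * m + 1) * (A / r) - m * A / (r - 1))"
      unfolding F_def times_divide_eq_right[of "m * (m + 1)"] pw A_def[symmetric] ..
    have F0: "F m = r * (1 - r) / 2 * (- (m * B) / (r + 1) + (2 * m + 1) * (B / r) - (m + 1) * B / (r - 1))"
      unfolding F_def times_divide_eq_right[of "m * (m + 1)"] pw B_def[symmetric] ..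
    have T: "trapezoid_defect r n = ((m + 1) * A - m * B) / (r + 1) - (B + A) / 2"
      unfolding trapezoid_defect_def using pw by (simp add: m_def A_def B_def add_ac)
    have nz: "r \<noteq> 0" "r + 1 \<noteq> 0" "r - 1 \<noteq> 0" using r by auto
    have "F (m + 1) = A * ((m + 1) / (r + 1) - 1 / 2)"
      unfolding F1 using nz by (simp add: divide_simps) algebra
    moreover have "F m = B * (m / (r + 1) + 1 / 2)"
      unfolding F0 using nz by (simp add: divide_simps) algebra
    ultimately show ?thesis unfolding T using nz by (simp add: field_simps)
  qed
  ultimately show ?thesis by (simp add: m_def add_ac)
qed

section \<open>Positivity and Laplace transform of the Peano kernel\<close>

lemma trapezoid_defect_nonneg:
  assumes r: "0 < r" "r < 1"
  shows "trapezoid_defect r n \<ge> 0"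
proof (rule has_integral_nonneg[OF trapezoid_defect_has_integral[OF r]])
  fix t assume t: "t \<in> {real n..real (Suc n)}"
  hence "0 \<le> (t - real n) * (real (Suc n) - t) / 2" by (intro divide_nonneg_pos mult_nonneg_nonneg) auto
  thus "0 \<le> r * (1 - r) * ((t - real n) * (real (Suc n) - t) / 2) * t powr (r - 2)"
    using r by (intro mult_nonneg_nonneg) auto
qed

lemma trapezoid_kernel_laplace:
  fixes x :: real
  assumes x: "x > 0"
  shows "((\<lambda>t. (t - real n) * (real (Suc n) - t) / 2 * exp (- x * t)) has_integral
      (exp (- x) ^ n * ((1 + exp (- x)) / 2 - (1 - exp (- x)) / x) / x ^ 2)) {real n..real (Suc n)}"
proof -
  define m where "m = real n"
  \<comment> \<open>Repeated integration by parts: for a quadratic Q an antiderivative of Q(t)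
    exp(-x t) is -exp(-x t) (Q/x + Q'/x^2 + Q''/x^3), and here Q'' = -1.\<close>
  define F where "F = (\<lambda>t. - exp (- x * t) * ((t - m) * (m + 1 - t) / 2 / x + (2 * m + 1 - 2 * t) / 2 / x ^ 2 - 1 / x ^ 3))"
  have "((\<lambda>t. (t - m) * (m + 1 - t) / 2 * exp (- x * t)) has_integral (F (m + 1) - F m)) {m..m + 1}"
  proof (rule fundamental_theorem_of_calculus)
    fix t
    have q: "((\<lambda>t. (t - m) * (m + 1 - t) / 2) has_real_derivative (2 * m + 1 - 2 * t) / 2) (at t within {m..m+1})"
      by (auto intro!: derivative_eq_intros simp: field_simps)
    have l: "((\<lambda>t. (2 * m + 1 - 2 * t) / 2) has_real_derivative - 1) (at t within {m..m+1})"
      by (auto intro!: derivative_eq_intros)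
    have e: "((\<lambda>t. - exp (- x * t)) has_real_derivative x * exp (- x * t)) (at t within {m..m+1})"
      by (auto intro!: derivative_eq_intros)
    have alg: "x * E * (Q / x + L / x ^ 2 - 1 / x ^ 3) + (L / x + - 1 / x ^ 2 - 0) * - E = Q * E" for E Q L
      using x by (simp add: field_simps power2_eq_square power3_eq_cube)
    have "(F has_real_derivative (t - m) * (m + 1 - t) / 2 * exp (- x * t)) (at t within {m..m+1})"
      unfolding F_def
      by (rule DERIV_cong[OF DERIV_mult[OF e DERIV_diff[OF DERIV_add[OF DERIV_cdivide[OF q] DERIV_cdivide[OF l]] DERIV_const]] alg])
    thus "(F has_vector_derivative (t - m) * (m + 1 - t) / 2 * exp (- x * t)) (at t within {m..m+1})"
      by (simp add: has_real_derivative_iff_has_vector_derivative)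
  qed simp
  moreover have "F (m + 1) - F m = exp (- x) ^ n * ((1 + exp (- x)) / 2 - (1 - exp (- x)) / x) / x ^ 2"
  proof -
    have "exp (- x * m) = exp (- x) ^ n"
      using exp_of_nat_mult[of n "- x"] by (simp add: m_def mult.commute)
    moreover have "exp (- x * (m + 1)) = exp (- x * m) * exp (- x)" by (simp add: exp_add[symmetric] algebra_simps)
    \<comment> \<open>The kernel vanishes at both endpoints and has slope 1/2 at the left and -1/2
      at the right one.\<close>
    ultimately have "F (m + 1) - F m =
        - (exp (- x) ^ n * exp (- x)) * (0 / 2 / x + (- 1) / 2 / x ^ 2 - 1 / x ^ 3)
        + exp (- x) ^ n * (0 / 2 / x + 1 / 2 / x ^ 2 - 1 / x ^ 3)"
      by (simp add: F_def)
    also have "- (A * q) * (0 / 2 / x + (- 1) / 2 / x ^ 2 - 1 / x ^ 3) + A * (0 / 2 / x + 1 / 2 / x ^ 2 - 1 / x ^ 3)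
        = A * ((1 + q) / 2 - (1 - q) / x) / x ^ 2" for A q
      using x by (simp add: field_simps power2_eq_square power3_eq_cube)
    finally show ?thesis .
  qed
  ultimately show ?thesis by (simp add: m_def add_ac)
qed

text \<open>A geometric series in exp(-x); its value is the left-hand function of the coth
  expansion, coth(x/2)/2 - 1/x, divided by x^2.\<close>

lemma trapezoid_kernel_laplace_sums:
  fixes x :: real
  assumes x: "x > 0"
  shows "(\<lambda>n. exp (- x) ^ n * ((1 + exp (- x)) / 2 - (1 - exp (- x)) / x) / x ^ 2) sums
           (((1 + exp (- x)) / (2 * (1 - exp (- x))) - 1 / x) / x ^ 2)"
proof -
  have q: "norm (exp (- x)) < 1" using x by simp
  have "1 / p * (u / 2 - p / x) = u / (2 * p) - 1 / x" if "p \<noteq> 0" for p u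
    using that x by (simp add: field_simps)
  hence eq: "1 / (1 - exp (- x)) * ((1 + exp (- x)) / 2 - (1 - exp (- x)) / x) =
      (1 + exp (- x)) / (2 * (1 - exp (- x))) - 1 / x"
    using q by simp
  have "(\<lambda>n. exp (- x) ^ n * ((1 + exp (- x)) / 2 - (1 - exp (- x)) / x) / x ^ 2) sums
      (1 / (1 - exp (- x)) * ((1 + exp (- x)) / 2 - (1 - exp (- x)) / x) / x ^ 2)"
    by (intro sums_divide sums_mult2 geometric_sums q)
  thus ?thesis unfolding eq .
qed

text \<open>Both sides evaluate one integral over x > 0: the sum over n comes from Laplace
  transforms of the Peano kernels, the sum over m from the partial fractions of coth. Working in
  \<open>ennreal\<close> reduces each interchange to measurability and postpones finiteness.\<close>

lemma suminf_trapezoid_defect: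
  assumes r: "0 < r" "r < 1"
  shows "(\<Sum>n. ennreal (trapezoid_defect r n)) =
    ennreal (r * (1 - r) / Gamma (2 - r) * (Gamma ((1 - r) / 2) * Gamma ((1 + r) / 2))) *
      (\<Sum>m. ennreal ((2 * pi * real (Suc m)) powr (- 1 - r)))"
proof -
  \<comment> \<open>The factor r(1 - r) comes from the second derivative of t^r, and 1/Gamma(2 - r)
    normalizes the Gamma integral for t^(r - 2).\<close>
  define c where "c = r * (1 - r) / Gamma (2 - r)"
  define k where "k = (\<lambda>n t. (t - real n) * (real (Suc n) - t) / 2)"
  define K :: "nat \<Rightarrow> real \<Rightarrow> real" where "K = (\<lambda>n x. exp (- x) ^ n * ((1 + exp (- x)) / 2 - (1 - exp (- x)) / x) / x ^ 2)"
  have G: "Gamma (2 - r) > 0" using r by (intro Gamma_real_pos) auto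
  have c: "c \<ge> 0" using r G by (simp add: c_def)
  have k: "k n t \<ge> 0" if "t \<in> {real n..real (Suc n)}" for n t
    unfolding k_def using that by (intro divide_nonneg_pos mult_nonneg_nonneg) auto
  have [measurable]: "k n \<in> borel_measurable borel" "K n \<in> borel_measurable borel" for n
    unfolding k_def K_def by measurable
  have K: "(\<integral>\<^sup>+t. ennreal (k n t * exp (- x * t)) * indicator {real n..real (Suc n)} t \<partial>lborel) = ennreal (K n x)"
    "K n x \<ge> 0" if "x > 0" for n x
    using trapezoid_kernel_laplace[OF that, of n] k
    by (auto simp: k_def K_def intro!: nn_integral_has_integral_lebesgue' dest: has_integral_nonneg)
  have U: "ennreal (trapezoid_defect r n) =
      (\<integral>\<^sup>+x. ennreal (c * x powr (1 - r) * K n x) * indicator {0<..} x \<partial>lborel)" for n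
  proof -
    have "ennreal (trapezoid_defect r n) = (\<integral>\<^sup>+t. ennreal (r * (1 - r) * k n t * t powr (r - 2)) * indicator {real n..real (Suc n)} t \<partial>lborel)"
      unfolding k_def using trapezoid_defect_has_integral[OF r, of n] k[of _ n] r
      by (intro nn_integral_has_integral_lebesgue'[symmetric]) (auto simp: k_def)
    also have "\<dots> = (\<integral>\<^sup>+t. \<integral>\<^sup>+x. ennreal (c * k n t * x powr (1 - r) * exp (- t * x)) * indicator {0<..} x * indicator {real n..real (Suc n)} t \<partial>lborel \<partial>lborel)"
    proof (intro nn_integral_cong)
      fix t :: real
      consider "t \<notin> {real n..real (Suc n)}" | "t \<le> 0" "t \<in> {real n..real (Suc n)}" | "t > 0" "t \<in> {real n..real (Suc n)}"
        by linarith
      thus "ennreal (r * (1 - r) * k n t * t powr (r - 2)) * indicator {real n..real (Suc n)} t =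
        (\<integral>\<^sup>+x. ennreal (c * k n t * x powr (1 - r) * exp (- t * x)) * indicator {0<..} x * indicator {real n..real (Suc n)} t \<partial>lborel)"
      proof cases
        \<comment> \<open>Only t = 0 with n = 0 remains. The Gamma integral requires t > 0, but the
          kernel vanishes at this endpoint, so both sides are 0.\<close>
        case 2
        hence "real n \<le> 0" by (auto intro: order_trans)
        hence "t = 0" "n = 0" using 2 by auto
        thus ?thesis by (simp add: k_def)
      next
        case 3
        have "(\<integral>\<^sup>+x. ennreal (c * k n t * x powr (1 - r) * exp (- t * x)) * indicator {0<..} x * indicator {real n..real (Suc n)} t \<partial>lborel)
          = (\<integral>\<^sup>+x. ennreal (c * k n t) * (ennreal (x powr ((2 - r) - 1) * exp (- t * x)) * indicator {0<..} x) \<partial>lborel)"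
          using 3 c k[of t n] by (intro nn_integral_cong) (auto simp: indicator_def ennreal_mult'[symmetric] mult_ac)
        also have "\<dots> = ennreal (c * k n t) * ennreal (Gamma (2 - r) * t powr (- (2 - r)))"
          using nn_integral_powr_exp[of "2 - r" t] 3 r by (subst nn_integral_cmult) auto
        also have "\<dots> = ennreal (c * k n t * (Gamma (2 - r) * t powr (- (2 - r))))"
          using c k[of t n] 3 by (intro ennreal_mult'[symmetric] mult_nonneg_nonneg)
        also have "c * k n t * (Gamma (2 - r) * t powr (- (2 - r))) = r * (1 - r) * k n t * t powr (r - 2)"
          using G by (simp add: c_def)
        finally show ?thesis using 3 by simp
      qed simp
    qed
    also have "\<dots> = (\<integral>\<^sup>+x. \<integral>\<^sup>+t. ennreal (c * k n t * x powr (1 - r) * exp (- t * x)) * indicator {0<..} x * indicator {real n..real (Suc n)} t \<partial>lborel \<partial>lborel)"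
      by (rule lborel_pair.Fubini') measurable
    also have "\<dots> = (\<integral>\<^sup>+x. ennreal (c * x powr (1 - r) * K n x) * indicator {0<..} x \<partial>lborel)"
    proof (intro nn_integral_cong)
      fix x :: real
      show "(\<integral>\<^sup>+t. ennreal (c * k n t * x powr (1 - r) * exp (- t * x)) * indicator {0<..} x * indicator {real n..real (Suc n)} t \<partial>lborel)
          = ennreal (c * x powr (1 - r) * K n x) * indicator {0<..} x"
      proof (cases "x > 0")
        case True
        have "(\<integral>\<^sup>+t. ennreal (c * k n t * x powr (1 - r) * exp (- t * x)) * indicator {0<..} x * indicator {real n..real (Suc n)} t \<partial>lborel)
          = (\<integral>\<^sup>+t. ennreal (c * x powr (1 - r)) * (ennreal (k n t * exp (- x * t)) * indicator {real n..real (Suc n)} t) \<partial>lborel)"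
          using True c by (intro nn_integral_cong) (auto simp: indicator_def ennreal_mult'[symmetric] mult_ac)
        also have "\<dots> = ennreal (c * x powr (1 - r)) * ennreal (K n x)"
          using K(1)[OF True] by (subst nn_integral_cmult) auto
        finally show ?thesis using True c by (simp add: ennreal_mult')
      qed simp
    qed
    finally show ?thesis .
  qed
  have "(\<Sum>n. ennreal (trapezoid_defect r n)) =
      (\<integral>\<^sup>+x. (\<Sum>n. ennreal (c * x powr (1 - r) * K n x) * indicator {0<..} x) \<partial>lborel)"
    unfolding U by (rule nn_integral_suminf[symmetric]) measurable
  also have "\<dots> = (\<integral>\<^sup>+x. (\<Sum>m. ennreal c * (ennreal (2 * x powr (- r) / (x ^ 2 + (2 * pi * real (Suc m)) ^ 2)) * indicator {0<..} x)) \<partial>lborel)"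
  proof (intro nn_integral_cong)
    fix x :: real
    show "(\<Sum>n. ennreal (c * x powr (1 - r) * K n x) * indicator {0<..} x) =
       (\<Sum>m. ennreal c * (ennreal (2 * x powr (- r) / (x ^ 2 + (2 * pi * real (Suc m)) ^ 2)) * indicator {0<..} x))"
    proof (cases "x > 0")
      case True
      \<comment> \<open>Evaluating \<open>S\<close> once by the geometric series and once by partial
        fractions identifies the two sums pointwise in x.\<close>
      define S where "S = ((1 + exp (- x)) / (2 * (1 - exp (- x))) - 1 / x)"
      have "(\<lambda>n. c * x powr (1 - r) * K n x) sums (c * x powr (1 - r) * (S / x ^ 2))"
        unfolding K_def S_def using True by (intro sums_mult trapezoid_kernel_laplace_sums)
      hence 1: "(\<Sum>n. ennreal (c * x powr (1 - r) * K n x)) = ennreal (c * x powr (1 - r) * (S / x ^ 2))"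
        using K(2)[OF True] c by (intro suminf_ennreal_eq) auto
      have "(\<lambda>m. c * x powr (1 - r) * (2 * x / (x ^ 2 + (2 * pi * real (Suc m)) ^ 2) / x ^ 2)) sums (c * x powr (1 - r) * (S / x ^ 2))"
        unfolding S_def using True by (intro sums_mult sums_divide coth_partial_fractions)
      also have "(\<lambda>m. c * x powr (1 - r) * (2 * x / (x ^ 2 + (2 * pi * real (Suc m)) ^ 2) / x ^ 2)) =
          (\<lambda>m. c * (2 * x powr (- r) / (x ^ 2 + (2 * pi * real (Suc m)) ^ 2)))"
        using True by (auto simp: fun_eq_iff powr_diff powr_minus power2_eq_square divide_simps)
      finally have 2: "(\<Sum>m. ennreal (c * (2 * x powr (- r) / (x ^ 2 + (2 * pi * real (Suc m)) ^ 2)))) = ennreal (c * x powr (1 - r) * (S / x ^ 2))"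
        using c by (intro suminf_ennreal_eq) auto
      show ?thesis using True c 1 2 by (simp add: ennreal_mult'[symmetric])
    qed simp
  qed
  also have "\<dots> = (\<Sum>m. \<integral>\<^sup>+x. ennreal c * (ennreal (2 * x powr (- r) / (x ^ 2 + (2 * pi * real (Suc m)) ^ 2)) * indicator {0<..} x) \<partial>lborel)"
    by (rule nn_integral_suminf) measurable
  also have "\<dots> = (\<Sum>m. ennreal (c * (Gamma ((1 - r) / 2) * Gamma ((1 + r) / 2))) * ennreal ((2 * pi * real (Suc m)) powr (- 1 - r)))"
  proof (intro suminf_cong)
    fix m
    have g: "Gamma ((1 - r) / 2) > 0" "Gamma ((1 + r) / 2) > 0" using r by simp_all
    have "2 * pi * real (Suc m) > 0" by simp
    from nn_integral_powr_over_sum_squares[OF r this]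
    show "(\<integral>\<^sup>+x. ennreal c * (ennreal (2 * x powr (- r) / (x ^ 2 + (2 * pi * real (Suc m)) ^ 2)) * indicator {0<..} x) \<partial>lborel)
       = ennreal (c * (Gamma ((1 - r) / 2) * Gamma ((1 + r) / 2))) * ennreal ((2 * pi * real (Suc m)) powr (- 1 - r))"
      using c g by (subst nn_integral_cmult) (auto simp: ennreal_mult'[symmetric] mult.assoc)
  qed
  finally show ?thesis unfolding c_def by simp
qed

section \<open>The functional equation\<close>

lemma Gamma_reflection_real: "Gamma x * Gamma (1 - x :: real) = pi / sin (pi * x)"
proof -
  have "complex_of_real (Gamma x * Gamma (1 - x)) = of_real (pi / sin (pi * x))"
  proof -
    have "Gamma (1 - complex_of_real x) = of_real (Gamma (1 - x))"
      using Gamma_complex_of_real[of "1 - x"] by simp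
    moreover have "sin (of_real pi * of_real x) = complex_of_real (sin (pi * x))"
      by (simp only: sin_of_real[symmetric] of_real_mult)
    ultimately show ?thesis
      using Gamma_reflection_complex[of "of_real x"] by (simp add: Gamma_complex_of_real)
  qed
  thus ?thesis by (simp only: of_real_eq_iff)
qed

text \<open>The reflection formula at (1 - r)/2 and at r, linked by the double angle formula for
  sin(pi r), brings the constant into its classical form.\<close>

lemma functional_equation_constant:
  fixes r :: real
  assumes r: "0 < r" "r < 1"
  shows "r * (1 - r) / Gamma (2 - r) * (Gamma ((1 - r) / 2) * Gamma ((1 + r) / 2))
           = 2 * sin (pi * r / 2) * Gamma (1 + r)"
proof -
  define s c where "s = sin (pi * r / 2)" and "c = cos (pi * r / 2)"
  have c: "c > 0" unfolding c_def using r by (intro cos_gt_zero) (auto simp: field_simps)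
  have s: "s > 0" unfolding s_def using r by (intro sin_gt_zero) (auto simp: field_simps)
  have "sin (pi * ((1 - r) / 2)) = sin (pi / 2 - pi * r / 2)"
    by (rule arg_cong[where f = sin]) (simp add: field_simps)
  hence "sin (pi * ((1 - r) / 2)) = c" by (simp add: c_def sin_diff)
  moreover have "1 - (1 - r) / 2 = (1 + r) / 2" by (simp add: field_simps)
  ultimately have 1: "Gamma ((1 - r) / 2) * Gamma ((1 + r) / 2) = pi / c"
    using Gamma_reflection_real[of "(1 - r) / 2"] by (simp only:)
  have "sin (pi * r) = sin (2 * (pi * r / 2))" by simp
  hence "sin (pi * r) = 2 * s * c" unfolding sin_double by (simp add: s_def c_def)
  hence 2: "Gamma r * Gamma (1 - r) = pi / (2 * s * c)"
    using Gamma_reflection_real[of r] by simp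
  have 3: "Gamma (2 - r) = (1 - r) * Gamma (1 - r)"
    using Gamma_plus1[of "1 - r"] r nonpos_Ints_nonpos[of "1 - r"] by fastforce
  have 4: "Gamma (1 + r) = r * Gamma r"
    using Gamma_plus1[of r] r nonpos_Ints_nonpos[of r] by (fastforce simp: add.commute)
  have G: "Gamma (1 - r) > 0" using r by (intro Gamma_real_pos) auto
  have 5: "pi / c = 2 * s * (Gamma r * Gamma (1 - r))" unfolding 2 using s by simp
  show ?thesis unfolding 1 3 4 5 s_def[symmetric] using r less_imp_neq[OF G] by simp
qed

text \<open>The two sums in \<open>suminf_trapezoid_defect\<close> are -zeta(-r) and a multiple of
  zeta(1 + r). With the entire function \<open>rGamma\<close> on the left, a zero of zeta at 1 - w
  directly annihilates the product on the right.\<close>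

lemma zeta_functional_equation_real:
  fixes r :: real
  assumes r: "0 < r" "r < 1"
  defines "w \<equiv> complex_of_real (1 + r)"
  shows "rGamma w * zeta (1 - w) = 2 * cos (of_real pi * w / 2) * of_real (2 * pi) powr (- w) * zeta w"
proof -
  define C where "C = 2 * sin (pi * r / 2) * Gamma (1 + r)"
  define Z where "Z = Re (- zeta (- of_real r))"
  define Y where "Y = Re (zeta w)"
  have "(\<lambda>n. complex_of_real (trapezoid_defect r n)) sums (- zeta (- of_real r))"
    by (rule trapezoid_defect_sums[OF r])
  \<comment> \<open>The terms are real, so the imaginary part of the value is a sum of zeros and the
    value equals its real part.\<close>
  hence Z: "trapezoid_defect r sums Z" "- zeta (- of_real r) = of_real Z"
    unfolding sums_complex_iff Z_def by (auto simp: complex_eq_iff dest: sums_unique2[OF sums_zero])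
  have "Re w > 1" using r by (simp add: w_def)
  hence "(\<lambda>n. complex_of_nat (Suc n) powr (- w)) sums zeta w"
    using dzeta_sums zeta_eq_dzeta by metis
  also have "(\<lambda>n. complex_of_nat (Suc n) powr (- w)) = (\<lambda>n. of_real (real (Suc n) powr (- 1 - r)))"
  proof
    fix n
    have "- w = of_real (- 1 - r)" by (simp add: w_def)
    thus "complex_of_nat (Suc n) powr (- w) = of_real (real (Suc n) powr (- 1 - r))"
      using powr_of_real[of "real (Suc n)" "- 1 - r"] by (simp del: of_nat_Suc)
  qed
  finally have Y: "(\<lambda>n. real (Suc n) powr (- 1 - r)) sums Y" "zeta w = of_real Y"
    unfolding sums_complex_iff Y_def by (auto simp: complex_eq_iff dest: sums_unique2[OF sums_zero])
  have "(\<lambda>n. (2 * pi * real (Suc n)) powr (- 1 - r)) = (\<lambda>n. (2 * pi) powr (- 1 - r) * real (Suc n) powr (- 1 - r))"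
    by (simp add: powr_mult del: of_nat_Suc)
  with sums_mult[OF Y(1)] have Y': "(\<lambda>n. (2 * pi * real (Suc n)) powr (- 1 - r)) sums ((2 * pi) powr (- 1 - r) * Y)"
    by metis
  have "Y \<ge> 0" using Y(1) by (rule sums_le[OF _ sums_zero, rotated]) auto
  have "Z \<ge> 0" using Z(1) trapezoid_defect_nonneg[OF r] by (intro sums_le[OF _ sums_zero Z(1)]) auto
  have C: "C \<ge> 0" unfolding C_def using r
    by (intro mult_nonneg_nonneg sin_ge_zero less_imp_le[OF Gamma_real_pos]) (auto simp: field_simps)
  have "ennreal Z = (\<Sum>n. ennreal (trapezoid_defect r n))"
    using Z(1) trapezoid_defect_nonneg[OF r] by (intro suminf_ennreal_eq[symmetric])
  also have "\<dots> = ennreal C * (\<Sum>n. ennreal ((2 * pi * real (Suc n)) powr (- 1 - r)))"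
    unfolding suminf_trapezoid_defect[OF r] functional_equation_constant[OF r] C_def ..
  also have "(\<Sum>n. ennreal ((2 * pi * real (Suc n)) powr (- 1 - r))) = ennreal ((2 * pi) powr (- 1 - r) * Y)"
    by (rule suminf_ennreal_eq[OF _ Y']) (rule powr_ge_zero)
  finally have "Z = C * ((2 * pi) powr (- 1 - r) * Y)"
    using C \<open>Y \<ge> 0\<close> \<open>Z \<ge> 0\<close> by (simp add: ennreal_mult'[symmetric])
  moreover have "rGamma (1 + r) * Gamma (1 + r) = 1"
  proof -
    have "Gamma (1 + r) > 0" using r by (intro Gamma_real_pos) simp
    thus ?thesis by (simp add: rGamma_inverse_Gamma)
  qed
  ultimately have real: "rGamma (1 + r) * Z = 2 * sin (pi * r / 2) * (2 * pi) powr (- 1 - r) * Y"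
    by (simp add: C_def mult.left_commute mult.assoc) (simp add: mult.commute mult.left_commute)?
  have "cos (of_real pi * w / 2) = of_real (cos (pi / 2 + pi * r / 2))"
    by (simp only: cos_of_real[symmetric]) (simp add: w_def field_simps)
  \<comment> \<open>This minus sign matches the one in Z = -zeta(-r).\<close>
  hence cos: "cos (of_real pi * w / 2) = - of_real (sin (pi * r / 2))"
    by (simp add: cos_add)
  have "- w = of_real (- 1 - r)" by (simp add: w_def)
  hence pow: "of_real (2 * pi) powr (- w) = complex_of_real ((2 * pi) powr (- 1 - r))"
    using powr_of_real[of "2 * pi" "- 1 - r"] by simp
  have "rGamma w * zeta (1 - w) = - of_real (rGamma (1 + r) * Z)"
  proof -
    have "1 - w = - of_real r" by (simp add: w_def)
    hence "zeta (1 - w) = - of_real Z" using Z(2) by (metis minus_minus)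
    moreover have "rGamma w = of_real (rGamma (1 + r))" unfolding w_def by (rule rGamma_complex_of_real)
    ultimately show ?thesis by simp
  qed
  also have "\<dots> = 2 * cos (of_real pi * w / 2) * of_real (2 * pi) powr (- w) * zeta w"
    unfolding real cos pow Y(2) by simp
  finally show ?thesis .
qed

text \<open>Both sides are holomorphic on the right half-plane without 1 and agree on the real
  interval (1, 2), which accumulates at 3/2; the identity theorem applies.\<close>

lemma zeta_functional_equation:
  assumes w: "Re w > 0" "w \<noteq> 1"
  shows "rGamma w * zeta (1 - w) = 2 * cos (of_real pi * w / 2) * of_real (2 * pi) powr (- w) * zeta w"
proof -
  define f where "f = (\<lambda>w. rGamma w * zeta (1 - w) - 2 * cos (of_real pi * w / 2) * of_real (2 * pi) powr (- w) * zeta w)"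
  let ?S = "{w. Re w > 0} - {1} :: complex set"
  have zeta_hol: "zeta holomorphic_on (- {1})" using is_zeta_zeta by (simp add: is_zeta_def)
  have "f w = 0"
  proof (rule analytic_continuation[where f = f and S = ?S and U = "(\<lambda>r. complex_of_real (1 + r)) ` {0<..<1}" and \<xi> = "3 / 2"])
    have "(\<lambda>w. zeta (1 - w)) holomorphic_on ?S"
      by (rule holomorphic_on_compose_gen[OF _ zeta_hol, unfolded o_def]) (auto intro!: holomorphic_intros)
    moreover have "zeta holomorphic_on ?S" by (rule holomorphic_on_subset[OF zeta_hol]) auto
    ultimately show "f holomorphic_on ?S"
      unfolding f_def by (intro holomorphic_intros) auto
    show "open ?S" by (intro open_delete open_halfspace_Re_gt)
    show "connected ?S"
      by (intro connected_open_delete open_halfspace_Re_gt convex_connected convex_halfspace_Re_gt) simp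
    show "(\<lambda>r. complex_of_real (1 + r)) ` {0<..<1} \<subseteq> ?S" by (auto simp: complex_eq_iff)
    show "3 / 2 islimpt (\<lambda>r. complex_of_real (1 + r)) ` {0<..<1}"
      unfolding islimpt_approachable
    proof (intro allI impI)
      fix e :: real assume e: "e > 0"
      \<comment> \<open>The point 3/2 + d differs from 3/2, stays inside (1, 2) and is closer than
        e.\<close>
      define d where "d = min (e / 2) (1 / 4)"
      have d: "d > 0" "d < e" "d < 1 / 2" using e by (auto simp: d_def)
      have "complex_of_real (1 + (1 / 2 + d)) - 3 / 2 = of_real d" by simp
      hence "complex_of_real (1 + (1 / 2 + d)) \<noteq> 3 / 2" "dist (complex_of_real (1 + (1 / 2 + d))) (3 / 2) < e"
        using d unfolding dist_norm by auto
      thus "\<exists>x'\<in>(\<lambda>r. complex_of_real (1 + r)) ` {0<..<1}. x' \<noteq> 3 / 2 \<and> dist x' (3 / 2) < e"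
        using d by (intro bexI[of _ "complex_of_real (1 + (1 / 2 + d))"] imageI conjI) auto
    qed
    show "f z = 0" if "z \<in> (\<lambda>r. complex_of_real (1 + r)) ` {0<..<1}" for z
      using that zeta_functional_equation_real unfolding f_def by auto
  qed (use w in auto)
  thus ?thesis by (simp add: f_def)
qed

text \<open>A zero s with Re s < 1/2 reflects to w = 1 - s, where zeta is nonzero, so the cosine
  factor must vanish. Its zeros are the odd integers w = 2n + 1, which makes s = -2n a trivial zero
  once s = 0 is excluded.\<close>

lemma zeta_zero_Re_ge_half:
  assumes zero_free: "\<And>s. Re s > 1 / 2 \<Longrightarrow> s \<noteq> 1 \<Longrightarrow> zeta s \<noteq> 0"
    and s: "nontrivial_zeta_zero s"
  shows "Re s \<ge> 1 / 2"
proof (rule ccontr)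
  assume Re: "\<not> Re s \<ge> 1 / 2"
  have zero: "zeta s = 0" and nontriv: "\<And>n::nat. n \<ge> 1 \<Longrightarrow> s \<noteq> - 2 * of_nat n"
    using s by (auto simp: nontrivial_zeta_zero_def)
  have s0: "s \<noteq> 0" using zero zeta_0 by auto
  define w where "w = 1 - s"
  have w: "Re w > 1 / 2" "w \<noteq> 1" using Re s0 by (auto simp: w_def)
  have "2 * cos (of_real pi * w / 2) * of_real (2 * pi) powr (- w) * zeta w = 0"
    using zeta_functional_equation[of w] w zero by (simp add: w_def)
  hence "cos (of_real pi * w / 2) = 0" using zero_free[OF w] by simp
  then obtain n :: int where "of_real pi * w / 2 = of_real (of_int n * pi) + of_real pi / 2"
    unfolding cos_eq_0 by blast
  hence "of_real pi * w = of_real pi * (2 * of_int n + 1)" by (simp add: field_simps)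
  hence "w = 2 * of_int n + 1" by simp
  hence "- (- s) = - (2 * of_int n)" by (simp add: w_def)
  hence sn: "s = - 2 * of_int n" by simp
  have "n \<ge> 0" using Re unfolding sn by simp
  moreover have "n \<noteq> 0" using s0 sn by auto
  ultimately have "nat n \<ge> 1" "s = - 2 * of_nat (nat n)" using sn by auto
  thus False using nontriv by blast
qed

theorem theorem7p1:
  assumes "\<forall>\<alpha>::real. \<alpha> \<ge> 1 \<longrightarrow>
     bdd_above ((\<lambda>N. Lp_norm \<alpha> circle_measure (normalized_exp_sum liouville N)) ` {1..}) \<and>
     bdd_above ((\<lambda>N. Lp_norm \<alpha> circle_measure (normalized_exp_sum moebius_mu N)) ` {1..})"
  shows "\<forall>s. nontrivial_zeta_zero s \<longrightarrow> Re s = 1 / 2"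
proof (intro allI impI)
  have zero_free: "zeta s \<noteq> 0" if s: "Re s > 1 / 2" "s \<noteq> 1" for s
  proof -
    \<comment> \<open>With this exponent 2/\<open>\<alpha>\<close> is at most half the distance of
      Re s from 1/2, so \<open>\<beta>\<close> stays strictly below Re s; the maximum ensures
      \<open>\<alpha>\<close> \<ge> 1.\<close>
    define \<alpha> where "\<alpha> = max 1 (4 / (Re s - 1 / 2))"
    define \<beta> where "\<beta> = 1 / 2 + 2 / \<alpha>"
    have \<alpha>: "\<alpha> \<ge> 1" by (simp add: \<alpha>_def)
    have "4 / (Re s - 1 / 2) \<le> \<alpha>" by (simp add: \<alpha>_def)
    hence "2 / \<alpha> \<le> (Re s - 1 / 2) / 2" using s \<alpha> by (simp add: field_simps)
    hence \<beta>: "\<beta> > 0" "Re s > \<beta>" using s \<alpha> by (auto simp: \<beta>_def intro: add_pos_nonneg)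
    have "bdd_above ((\<lambda>N. Lp_norm \<alpha> circle_measure (normalized_exp_sum moebius_mu N)) ` {1..})"
      using assms[rule_format, OF \<alpha>] by (rule conjunct2)
    then obtain B where B: "\<And>N. N \<ge> 1 \<Longrightarrow> Lp_norm \<alpha> circle_measure (normalized_exp_sum moebius_mu N) \<le> B"
      unfolding bdd_above_def by auto
    have "real_of_int \<bar>\<Sum>j=1..N. moebius_mu j\<bar> \<le> (2 * (4 * pi) powr (1 / \<alpha>) * B) * real N powr \<beta>"
      if N: "N \<ge> 1" for N
    proof -
      have "real_of_int \<bar>\<Sum>j=1..N. moebius_mu j\<bar> \<le> 2 * (4 * pi) powr (1 / \<alpha>) *
          Lp_norm \<alpha> circle_measure (normalized_exp_sum moebius_mu N) * real N powr \<beta>"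
        unfolding \<beta>_def using abs_moebius_mu_le \<alpha> N by (intro sum_le_Lp_norm_exp_sum) auto
      also have "\<dots> \<le> (2 * (4 * pi) powr (1 / \<alpha>) * B) * real N powr \<beta>"
        using B[OF N] by (intro mult_right_mono mult_left_mono) auto
      finally show ?thesis .
    qed
    thus ?thesis using \<beta> s by (intro zeta_nonzero_of_mertens_bound) auto
  qed
  fix s assume s: "nontrivial_zeta_zero s"
  have "Re s \<ge> 1 / 2" using zeta_zero_Re_ge_half[OF zero_free s] by blast
  moreover have "\<not> Re s > 1 / 2" using zero_free s by (auto simp: nontrivial_zeta_zero_def)
  ultimately show "Re s = 1 / 2" by simp
qed

end
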